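(* Let $K$ be a class of total computable numerical functions containing all almost constant functions ($\mathrm{AC}\subseteq K$), and let $\widetilde K=(\widetilde K,0,Q^3_+,Q^3_-)$ be the structure generated by $K$. Put \begin{align*} A_0&=\{n\mid \pi_n\subseteq\{0,1,2\}\wedge n\notin\mathrm{Tot}\},\\ A_1&=\{n\mid \pi_n\subseteq\{0,1,2\}\wedge(n\notin\mathrm{Tot}\vee\varphi_n\in\mathrm{AC})\},\\ A_2&=\{n\mid \pi_n\subseteq\{0,1,2\}\wedge(n\notin\mathrm{Tot}\vee\overline{\varphi_n}\in\widetilde K)\}. \end{align*} If the structure $\widetilde K$ has a computable presentation, then $A_0\cup(A_2\setminus A_1)\in\Sigma^0_2$.
   Context: $\varphi_n$ is the partial computable function with Kleene index $n$, $\pi_n=\mathrm{im}(\varphi_n)$, $\mathrm{Tot}=\{n\mid\varphi_n\text{ is total}\}$. $\mathrm{AC}=\{f:\omega\to\omega\mid(\exists c)(\exists x)(\forall y>x)\,f(y)=c\}$ is the set of almost constant functions. For a total $f:\omega\to\{0,1,2\}$ put $\overline f=\sum_{i=0}^\infty\frac{f(i)-1}{2^{i+1}}$. The set of reals generated by $K$ is $\widetilde K=\{m+\overline f\mid m\in\mathbb{Z},\ f\in K,\ f:\omega\to\omega \text{ unary},\ \mathrm{im}(f)\subseteq\{0,1,2\}\}$. The structure $\widetilde K=(\widetilde K,0,Q^3_+,Q^3_-)$ has universe this set, the constant $0$, and the ternary relations $Q^3_+(x,y,z)\leftrightarrow x+y\le z$ and $Q^3_-(x,y,z)\leftrightarrow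 x+y\ge z$ (addition and order in $\mathbb{R}$). A computable presentation (copy) of a structure with universe $A$ is a surjection $\mu:\omega\to A$ with respect to which all relations and operations of the signature, including equality, are computable (a relation $R$ is computable with respect to $\mu$ if $\{\bar n\mid R(\mu(n_1),\dots,\mu(n_k))\}$ is computable). *)

theory Defs
  imports Complex_Main "HOL-Library.Nat_Bijection"
begin

text \<open>
  Kleene's partial recursive functions. Terms carry no arity: each term denotes one partial
  function on lists of numbers, and its restriction to lists of length k is a k-ary partial
  recursive function in the usual sense. A term is undefined where it lacks an argument it needs.
  \<open>PrimRec\<close> recurses on, and \<open>Mu\<close> searches for, the first argument.
\<close>

datatype recf =
    Zero
  | Succ
  | Proj nat
  | Comp recf "recf list"
  | PrimRec recf recf
  | Mu recf

fun eval :: "recf \<Rightarrow> nat list \<rightharpoonup> nat" where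
  "eval Zero xs = Some 0"
| "eval Succ xs = (case xs of [] \<Rightarrow> None | x # _ \<Rightarrow> Some (Suc x))"
| "eval (Proj i) xs = (if i < length xs then Some (xs ! i) else None)"
| "eval (Comp f gs) xs =
    (if \<forall>g\<in>set gs. eval g xs \<noteq> None then eval f (map (\<lambda>g. the (eval g xs)) gs) else None)"
| "eval (PrimRec f g) xs =
    (case xs of
       [] \<Rightarrow> None
     | x # ys \<Rightarrow> rec_nat (eval f ys) (\<lambda>t r. Option.bind r (\<lambda>v. eval g (t # v # ys))) x)"
| "eval (Mu f) xs =
    (if \<exists>y. eval f (y # xs) = Some 0 \<and> (\<forall>z<y. eval f (z # xs) \<noteq> None)
     then Some (LEAST y. eval f (y # xs) = Some 0) else None)"

fun encode :: "recf \<Rightarrow> nat" where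
  "encode Zero = 0"
| "encode Succ = 1"
| "encode (Proj i) = 4 * i + 2"
| "encode (Comp f gs) = 4 * prod_encode (encode f, list_encode (map encode gs)) + 3"
| "encode (PrimRec f g) = 4 * prod_encode (encode f, encode g) + 4"
| "encode (Mu f) = 4 * encode f + 5"

lemma inj_encode: "encode f = encode g \<Longrightarrow> f = g"
proof (induction f arbitrary: g)
  case Zero
  then show ?case by (cases g) auto
next
  case Succ
  then show ?case by (cases g) auto
next
  case (Proj i)
  then show ?case by (cases g; simp; presburger)
next
  case (Comp f fs)
  show ?case
  proof (cases g)
    case (Comp h hs)
    with Comp.prems have "encode f = encode h" and eq: "map encode fs = map encode hs"
      by (auto simp: prod_encode_eq list_encode_eq)
    moreover have "fs = hs"
      using eq Comp.IH(2) by (intro list.inj_map_strong[OF _ eq]) auto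
    ultimately show ?thesis using Comp Comp.IH(1) by simp
  qed (use Comp.prems in \<open>simp; presburger\<close>)+
next
  case (PrimRec f1 f2)
  then show ?case by (cases g; simp add: prod_encode_eq; presburger)
next
  case (Mu f)
  then show ?case by (cases g; simp; presburger)
qed

lemma list_decode_less: "x \<in> set (list_decode n) \<Longrightarrow> x < n"
proof (induction n arbitrary: x rule: less_induct)
  case (less n)
  show ?case
  proof (cases n)
    case 0
    with less.prems show ?thesis by simp
  next
    case (Suc m)
    obtain a b where ab: "prod_decode m = (a, b)" by fastforce
    then have "m = prod_encode (a, b)" by (metis prod_decode_inverse)
    then have "a \<le> m" "b \<le> m" by (simp_all add: le_prod_encode_1 le_prod_encode_2)
    moreover have "x = a \<or> x \<in> set (list_decode b)" using less.prems Suc ab by simp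
    moreover have "x \<in> set (list_decode b) \<Longrightarrow> x < b"
      using less.IH[of b] \<open>b \<le> m\<close> Suc by simp
    ultimately show ?thesis using Suc by auto
  qed
qed

lemma surj_encode: "\<exists>f. encode f = n"
proof (induction n rule: less_induct)
  case (less n)
  have "n = 0 \<or> n = 1 \<or> (\<exists>m. n = 4 * m + 2) \<or> (\<exists>m. n = 4 * m + 3) \<or>
      (\<exists>m. n = 4 * m + 4) \<or> (\<exists>m. n = 4 * m + 5)"
    by presburger
  then consider "n = 0" | "n = 1" | m where "n = 4 * m + 2" | m where "n = 4 * m + 3"
    | m where "n = 4 * m + 4" | m where "n = 4 * m + 5"
    by blast
  then show ?case
  proof cases
    case 1
    then show ?thesis by (intro exI[of _ Zero]) simp
  next
    case 2
    then show ?thesis by (intro exI[of _ Succ]) simp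
  next
    case (3 m)
    then show ?thesis by (intro exI[of _ "Proj m"]) simp
  next
    case (4 m)
    obtain a b where ab: "m = prod_encode (a, b)" by (metis prod_decode_inverse surj_pair)
    then have le: "a \<le> m" "b \<le> m" by (simp_all add: le_prod_encode_1 le_prod_encode_2)
    then obtain f where f: "encode f = a" using less.IH[of a] 4 by auto
    have ex: "\<exists>g. encode g = x" if "x \<in> set (list_decode b)" for x
      using list_decode_less[OF that] le 4 by (intro less.IH) simp
    then have "map (encode \<circ> (\<lambda>x. SOME g. encode g = x)) (list_decode b) = list_decode b"
      by (intro map_idI) (auto intro: someI_ex)
    then have "encode (Comp f (map (\<lambda>x. SOME g. encode g = x) (list_decode b))) = n"
      using f ab 4 by simp
    then show ?thesis ..
  next
    case (5 m)
    obtain a b where ab: "m = prod_encode (a, b)" by (metis prod_decode_inverse surj_pair)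
    then have "a \<le> m" "b \<le> m" by (simp_all add: le_prod_encode_1 le_prod_encode_2)
    then obtain f g where "encode f = a" "encode g = b"
      using less.IH[of a] less.IH[of b] 5 by auto
    then show ?thesis using ab 5 by (intro exI[of _ "PrimRec f g"]) simp
  next
    case (6 m)
    then obtain f where "encode f = m" using less.IH[of m] by auto
    then show ?thesis using 6 by (intro exI[of _ "Mu f"]) simp
  qed
qed

lemma bij_encode: "bij encode"
  by (auto simp: bij_def inj_def surj_def intro: inj_encode) (metis surj_encode)

text \<open>
  The Kleene numbering: index n belongs to the term with code n, and since \<open>encode\<close> is a
  bijection every number is an index.
\<close>

definition phi :: "nat \<Rightarrow> nat \<rightharpoonup> nat" where
  "phi n x = eval (inv encode n) [x]"

definition Tot :: "nat set" where
  "Tot = {n. \<forall>x. phi n x \<noteq> None}"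

text \<open>
  Relations on numbers are predicates on lists; only lists of length k matter for a k-ary one.
\<close>

definition computable_rel :: "nat \<Rightarrow> (nat list \<Rightarrow> bool) \<Rightarrow> bool" where
  "computable_rel k R \<longleftrightarrow>
    (\<exists>c. \<forall>xs. length xs = k \<longrightarrow> eval c xs = Some (if R xs then 1 else 0))"

text \<open>
  A numerical function of arity k is a map whose domain is the set of lists of length k.
\<close>

definition total_computable :: "(nat list \<rightharpoonup> nat) \<Rightarrow> bool" where
  "total_computable F \<longleftrightarrow>
    (\<exists>k. dom F = {xs. length xs = k} \<and> (\<exists>c. \<forall>xs. length xs = k \<longrightarrow> eval c xs = F xs))"

definition unary :: "(nat \<Rightarrow> nat) \<Rightarrow> (nat list \<rightharpoonup> nat)" where
  "unary f xs = (if length xs = 1 then Some (f (hd xs)) else None)"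

definition Sigma02 :: "nat set set" where
  "Sigma02 = {A. \<exists>R. computable_rel 3 R \<and> A = {n. \<exists>x. \<forall>y. R [n, x, y]}}"

text \<open>
  A structure of finite signature. Operations and relations are paired with their arities and
  act on lists; constants are operations of arity 0.
\<close>

record 'a struct =
  universe :: "'a set"
  operations :: "(nat \<times> ('a list \<Rightarrow> 'a)) list"
  relations :: "(nat \<times> ('a list \<Rightarrow> bool)) list"

definition computable_presentation :: "(nat \<Rightarrow> 'a) \<Rightarrow> 'a struct \<Rightarrow> bool" where
  "computable_presentation \<mu> S \<longleftrightarrow>
    range \<mu> = universe S \<and>
    computable_rel 2 (\<lambda>ns. \<mu> (ns ! 0) = \<mu> (ns ! 1)) \<and>
    (\<forall>(k, R) \<in> set (relations S). computable_rel k (\<lambda>ns. R (map \<mu> ns))) \<and>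
    (\<forall>(k, F) \<in> set (operations S).
      \<exists>h. total_computable h \<and> dom h = {ns. length ns = k} \<and>
          (\<forall>ns. length ns = k \<longrightarrow> \<mu> (the (h ns)) = F (map \<mu> ns)))"

definition AC :: "(nat \<Rightarrow> nat) set" where
  "AC = {f. \<exists>c x. \<forall>y>x. f y = c}"

definition real_of :: "(nat \<Rightarrow> nat) \<Rightarrow> real" where
  "real_of f = (\<Sum>i. (real (f i) - 1) / 2 ^ (i + 1))"

definition generated_reals :: "(nat list \<rightharpoonup> nat) set \<Rightarrow> real set" where
  "generated_reals K =
    {real_of_int m + real_of f | m f. unary f \<in> K \<and> range f \<subseteq> {0, 1, 2}}"

definition generated_struct :: "(nat list \<rightharpoonup> nat) set \<Rightarrow> real struct" where
  "generated_struct K =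
    \<lparr> universe = generated_reals K,
      operations = [(0, \<lambda>_. 0)],
      relations = [(3, \<lambda>v. v ! 0 + v ! 1 \<le> v ! 2), (3, \<lambda>v. v ! 0 + v ! 1 \<ge> v ! 2)] \<rparr>"

definition A0 :: "nat set" where
  "A0 = {n. ran (phi n) \<subseteq> {0, 1, 2} \<and> n \<notin> Tot}"

definition A1 :: "nat set" where
  "A1 = {n. ran (phi n) \<subseteq> {0, 1, 2} \<and> (n \<notin> Tot \<or> (\<lambda>x. the (phi n x)) \<in> AC)}"

definition A2 :: "(nat list \<rightharpoonup> nat) set \<Rightarrow> nat set" where
  "A2 K = {n. ran (phi n) \<subseteq> {0, 1, 2} \<and>
             (n \<notin> Tot \<or> real_of (\<lambda>x. the (phi n x)) \<in> generated_reals K)}"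

end

theory Submission imports Defs begin

text \<open>
  Write \<open>f\<close> for \<open>\<phi>\<^sub>n\<close> and suppose that its values lie in \<open>{0, 1, 2}\<close>, which is a \<open>\<Pi>\<^sup>0\<^sub>1\<close> condition on
  \<open>n\<close>. Then \<open>n\<close> belongs to the set in question if and only if \<open>f\<close> is undefined at some argument, or \<open>f\<close> is
  total, not almost constant, and the expansion of an element of the structure. The first alternative is
  \<open>\<Sigma>\<^sup>0\<^sub>2\<close>. Since it already puts \<open>n\<close> into the set, totality need not be expressed in the second one;
  it suffices to find a \<open>\<Sigma>\<^sup>0\<^sub>2\<close> condition that is correct for total \<open>f\<close>.

  Let \<open>p\<^sub>N\<close> be the sum of the first \<open>N\<close> terms of the series of \<open>f\<close>. The remaining terms have a sum of
  absolute value at most \<open>1 / 2 ^ N\<close>; if it is \<open>0\<close> or attains the bound, then \<open>f\<close> is almost constant,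
  and if \<open>f\<close> is almost constant, then one of these happens for some \<open>N\<close>. So \<open>x\<close> is the real with
  expansion \<open>f\<close> and \<open>f\<close> is not almost constant if and only if \<open>\<bar>x - p\<^sub>N\<bar> < 1 / 2 ^ N\<close> and \<open>x \<noteq> p\<^sub>N\<close> for
  all \<open>N\<close> (lemma \<open>real_of_not_AC_iff\<close>). The reals \<open>p\<^sub>N\<close> and \<open>1 / 2 ^ N\<close> are generated by almost constant
  functions, hence they belong to the structure. In a computable presentation their indices are
  determined, up to equality, by decidable conditions: halve \<open>1\<close> repeatedly and add or subtract the
  results as the digits of \<open>f\<close> prescribe. The condition therefore says that there is an index \<open>e\<close>
  such that for all finite computations of digits and all lists of indices satisfying these
  conditions, decidable inequalities hold. This is \<open>\<Sigma>\<^sup>0\<^sub>2\<close>.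

  That a finite computation of a digit is a decidable object uniformly in \<open>n\<close> is Kleene's normal
  form theorem. It is proved for derivations, that is, coded lists of statements about values of
  terms in which every statement follows from the ones after it by the definition of evaluation
  (lemmas \<open>phi_eq_Some_iff\<close> and \<open>decidable_derivation\<close>).
\<close>

section \<open>Closure properties of the total recursive functions\<close>

text \<open>
  The function \<open>F\<close>, restricted to lists of length \<open>k\<close>, is a total recursive function of \<open>k\<close>
  arguments; its values on lists of other lengths are irrelevant.
\<close>

definition total_on_arity :: "nat \<Rightarrow> (nat list \<Rightarrow> nat) \<Rightarrow> bool" where
  "total_on_arity k F \<longleftrightarrow> (\<exists>c. \<forall>xs. length xs = k \<longrightarrow> eval c xs = Some (F xs))"

lemma total_on_arity_cong:
  assumes "total_on_arity k F" "\<And>xs. length xs = k \<Longrightarrow> F xs = G xs"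
  shows "total_on_arity k G"
  using assms unfolding total_on_arity_def by metis

lemma total_on_arity_proj: "i < k \<Longrightarrow> total_on_arity k (\<lambda>xs. xs ! i)"
  unfolding total_on_arity_def by (rule exI[of _ "Proj i"]) simp

lemma total_on_arity_compose:
  assumes F: "total_on_arity m F" and "length Gs = m" and Gs: "\<forall>G\<in>set Gs. total_on_arity k G"
  shows "total_on_arity k (\<lambda>xs. F (map (\<lambda>G. G xs) Gs))"
proof -
  obtain c where c: "\<And>xs. length xs = m \<Longrightarrow> eval c xs = Some (F xs)"
    using F unfolding total_on_arity_def by blast
  obtain d where d: "\<And>G xs. G \<in> set Gs \<Longrightarrow> length xs = k \<Longrightarrow> eval (d G) xs = Some (G xs)"
    using Gs unfolding total_on_arity_def by metis
  have "eval (Comp c (map d Gs)) xs = Some (F (map (\<lambda>G. G xs) Gs))" if "length xs = k" for xs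
  proof -
    have "map (\<lambda>G. the (eval G xs)) (map d Gs) = map (\<lambda>G. G xs) Gs"
      using d that by simp
    then show ?thesis
      using c[of "map (\<lambda>G. G xs) Gs"] d that \<open>length Gs = m\<close> by (simp del: map_map)
  qed
  then show ?thesis unfolding total_on_arity_def by blast
qed

lemma total_on_arity_compose1:
  assumes "total_on_arity 1 (\<lambda>xs. f (xs ! 0))" "total_on_arity k g"
  shows "total_on_arity k (\<lambda>xs. f (g xs))"
  using total_on_arity_compose[OF assms(1), of "[g]" k] assms(2) by simp

lemma total_on_arity_compose2:
  assumes "total_on_arity 2 (\<lambda>xs. f (xs ! 0) (xs ! 1))" "total_on_arity k g" "total_on_arity k h"
  shows "total_on_arity k (\<lambda>xs. f (g xs) (h xs))"
  using total_on_arity_compose[OF assms(1), of "[g, h]" k] assms(2,3) by simp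

lemma total_on_arity_compose3:
  assumes "total_on_arity 3 F"
    "total_on_arity k g" "total_on_arity k h" "total_on_arity k l"
  shows "total_on_arity k (\<lambda>xs. F [g xs, h xs, l xs])"
  using total_on_arity_compose[OF assms(1), of "[g, h, l]" k] assms(2-) by simp

lemma total_on_arity_Suc: "total_on_arity k g \<Longrightarrow> total_on_arity k (\<lambda>xs. Suc (g xs))"
proof (rule total_on_arity_compose1[where f = Suc])
  show "total_on_arity 1 (\<lambda>xs. Suc (xs ! 0))"
    unfolding total_on_arity_def
    by (rule exI[of _ Succ]) (auto split: list.split)
qed

lemma total_on_arity_const: "total_on_arity k (\<lambda>_. n)"
proof (induction n)
  case 0
  show ?case unfolding total_on_arity_def by (rule exI[of _ Zero]) simp
qed (rule total_on_arity_Suc)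

lemma total_on_arity_rec:
  assumes F: "total_on_arity k F" and G: "total_on_arity (Suc (Suc k)) G"
  shows "total_on_arity (Suc k) (\<lambda>xs. rec_nat (F (tl xs)) (\<lambda>t r. G (t # r # tl xs)) (hd xs))"
proof -
  obtain c d where c: "\<And>xs. length xs = k \<Longrightarrow> eval c xs = Some (F xs)"
    and d: "\<And>xs. length xs = Suc (Suc k) \<Longrightarrow> eval d xs = Some (G xs)"
    using F G unfolding total_on_arity_def by blast
  have "eval (PrimRec c d) (n # ys) = Some (rec_nat (F ys) (\<lambda>t r. G (t # r # ys)) n)"
    if "length ys = k" for n ys
    using that by (induction n) (simp_all add: c d)
  then have "eval (PrimRec c d) xs = Some (rec_nat (F (tl xs)) (\<lambda>t r. G (t # r # tl xs)) (hd xs))"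
    if "length xs = Suc k" for xs
    using that by (cases xs) simp_all
  then show ?thesis unfolding total_on_arity_def by blast
qed

lemma total_on_arity_Least:
  assumes F: "total_on_arity (Suc k) F" and ex: "\<And>xs. length xs = k \<Longrightarrow> \<exists>y. F (y # xs) = 0"
  shows "total_on_arity k (\<lambda>xs. LEAST y. F (y # xs) = 0)"
proof -
  obtain c where c: "\<And>xs. length xs = Suc k \<Longrightarrow> eval c xs = Some (F xs)"
    using F unfolding total_on_arity_def by blast
  have "eval (Mu c) xs = Some (LEAST y. F (y # xs) = 0)" if "length xs = k" for xs
    using that ex[OF that] by (simp add: c)
  then show ?thesis unfolding total_on_arity_def by blast
qed

lemma total_on_arity_rec1:
  assumes "total_on_arity 2 (\<lambda>xs. g (xs ! 0) (xs ! 1))"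
  shows "total_on_arity 1 (\<lambda>xs. rec_nat c g (xs ! 0))"
proof -
  have "total_on_arity (Suc 0)
      (\<lambda>xs. rec_nat c (\<lambda>t r. g ((t # r # tl xs) ! 0) ((t # r # tl xs) ! 1)) (hd xs))"
    using assms by (intro total_on_arity_rec total_on_arity_const)
      (simp add: numeral_2_eq_2)
  then show ?thesis
    unfolding One_nat_def by (rule total_on_arity_cong) (auto simp: length_Suc_conv)
qed

lemma total_on_arity_rec2:
  assumes "total_on_arity 1 (\<lambda>xs. f (xs ! 0))"
    "total_on_arity 3 (\<lambda>xs. g (xs ! 0) (xs ! 1) (xs ! 2))"
  shows "total_on_arity 2 (\<lambda>xs. rec_nat (f (xs ! 1)) (\<lambda>t r. g t r (xs ! 1)) (xs ! 0))"
proof -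
  have "total_on_arity (Suc 1) (\<lambda>xs. rec_nat (f (tl xs ! 0)) (\<lambda>t r. g ((t # r # tl xs) ! 0)
      ((t # r # tl xs) ! 1) ((t # r # tl xs) ! 2)) (hd xs))"
    using assms by (intro total_on_arity_rec) (simp_all add: numeral_3_eq_3)
  then show ?thesis
    unfolding Suc_1
    by (rule total_on_arity_cong) (auto simp: hd_conv_nth nth_tl numeral_2_eq_2 length_Suc_conv)
qed

lemma total_on_arity_add2: "total_on_arity 2 (\<lambda>xs. xs ! 0 + xs ! 1)"
proof -
  have "total_on_arity 2 (\<lambda>xs. rec_nat (xs ! 1) (\<lambda>t r. Suc r) (xs ! 0))"
    by (rule total_on_arity_rec2[where g = "\<lambda>t r x. Suc r"])
      (intro total_on_arity_Suc total_on_arity_proj; simp)+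
  moreover have "rec_nat y (\<lambda>t r. Suc r) x = x + y" for x y
    by (induction x) simp_all
  ultimately show ?thesis by simp
qed

lemmas total_on_arity_add = total_on_arity_compose2[OF total_on_arity_add2]

lemma total_on_arity_mult2: "total_on_arity 2 (\<lambda>xs. xs ! 0 * xs ! 1)"
proof -
  have "total_on_arity 2 (\<lambda>xs. rec_nat 0 (\<lambda>t r. r + xs ! 1) (xs ! 0))"
    by (rule total_on_arity_rec2[where f = "\<lambda>_. 0" and g = "\<lambda>t r x. r + x"])
      (intro total_on_arity_const total_on_arity_add total_on_arity_proj; simp)+
  moreover have "rec_nat 0 (\<lambda>t r. r + y) x = x * y" for x y :: nat
    by (induction x) simp_all
  ultimately show ?thesis by simp
qed

lemmas total_on_arity_mult = total_on_arity_compose2[OF total_on_arity_mult2]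

lemma total_on_arity_pred1: "total_on_arity 1 (\<lambda>xs. xs ! 0 - 1)"
proof -
  have "total_on_arity 1 (\<lambda>xs. rec_nat 0 (\<lambda>t r. t) (xs ! 0))"
    by (rule total_on_arity_rec1) (rule total_on_arity_proj, simp)
  moreover have "rec_nat 0 (\<lambda>t r. t) x = x - 1" for x
    by (cases x) simp_all
  ultimately show ?thesis by simp
qed

lemmas total_on_arity_pred = total_on_arity_compose1[OF total_on_arity_pred1]

lemma total_on_arity_diff2: "total_on_arity 2 (\<lambda>xs. xs ! 0 - xs ! 1)"
proof -
  have "total_on_arity 2 (\<lambda>xs. rec_nat (xs ! 1) (\<lambda>t r. r - 1) (xs ! 0))"
    by (rule total_on_arity_rec2[where f = "\<lambda>x. x" and g = "\<lambda>t r x. r - 1"])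
      (intro total_on_arity_pred total_on_arity_proj; simp)+
  moreover have "rec_nat y (\<lambda>t r. r - 1) x = y - x" for x y :: nat
    by (induction x) simp_all
  ultimately have "total_on_arity 2 (\<lambda>xs. xs ! 1 - xs ! 0)" by simp
  from total_on_arity_compose2[OF this, of 2 "\<lambda>xs. xs ! 1" "\<lambda>xs. xs ! 0"]
  show ?thesis by (simp add: total_on_arity_proj)
qed

lemmas total_on_arity_diff = total_on_arity_compose2[OF total_on_arity_diff2]

lemma total_on_arity_triangle1: "total_on_arity 1 (\<lambda>xs. triangle (xs ! 0))"
proof -
  have "total_on_arity 1 (\<lambda>xs. rec_nat 0 (\<lambda>t r. r + Suc t) (xs ! 0))"
    by (rule total_on_arity_rec1)
      (intro total_on_arity_add total_on_arity_Suc total_on_arity_proj; simp)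
  moreover have "rec_nat 0 (\<lambda>t r. r + Suc t) x = triangle x" for x
    by (induction x) (simp_all add: triangle_Suc)
  ultimately show ?thesis by simp
qed

lemmas total_on_arity_triangle = total_on_arity_compose1[OF total_on_arity_triangle1]

lemma triangle_mono: "m \<le> n \<Longrightarrow> triangle m \<le> triangle n"
  by (induction rule: dec_induct) (simp_all add: triangle_Suc)

text \<open>
  The pair coded by \<open>z\<close> lies on an antidiagonal that an unbounded search finds. This makes
  the projections of the pairing function recursive without following the recursion by which
  \<^const>\<open>prod_decode\<close> is defined.
\<close>

lemma sum_prod_decode_eq_Least:
  "fst (prod_decode z) + snd (prod_decode z) = (LEAST k. Suc z - triangle (Suc k) = 0)"
proof -
  obtain a b where ab: "prod_decode z = (a, b)" by fastforce
  then have z: "z = triangle (a + b) + a"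
    using prod_decode_inverse[of z] by (simp add: prod_encode_def)
  have "(LEAST k. Suc z - triangle (Suc k) = 0) = a + b"
  proof (rule Least_equality)
    show "Suc z - triangle (Suc (a + b)) = 0" using z by (simp add: triangle_Suc)
  next
    fix k assume "Suc z - triangle (Suc k) = 0"
    then have "triangle (a + b) < triangle (Suc k)" using z by simp
    then show "a + b \<le> k" using triangle_mono[of "Suc k" "a + b"] by (meson not_le not_less_eq_eq)
  qed
  then show ?thesis using ab by simp
qed

lemma total_on_arity_antidiagonal1:
  "total_on_arity 1 (\<lambda>xs. fst (prod_decode (xs ! 0)) + snd (prod_decode (xs ! 0)))"
proof -
  have "total_on_arity 1 (\<lambda>xs. LEAST k. Suc ((k # xs) ! 1) - triangle (Suc ((k # xs) ! 0)) = 0)"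
  proof (rule total_on_arity_Least)
    show "total_on_arity (Suc 1) (\<lambda>xs. Suc (xs ! 1) - triangle (Suc (xs ! 0)))"
      by (intro total_on_arity_diff total_on_arity_triangle total_on_arity_Suc total_on_arity_proj;
          simp)
    have "triangle (Suc z) \<ge> Suc z" for z by (simp add: triangle_Suc)
    then show "\<exists>y. Suc ((y # xs) ! 1) - triangle (Suc ((y # xs) ! 0)) = 0" for xs :: "nat list"
      by (intro exI[of _ "xs ! 0"]) (simp only: nth_Cons_0 nth_Cons_Suc One_nat_def diff_is_0_eq)
  qed
  then show ?thesis by (simp add: sum_prod_decode_eq_Least)
qed

lemmas total_on_arity_antidiagonal = total_on_arity_compose1[OF total_on_arity_antidiagonal1]

lemma total_on_arity_prod_encode:
  assumes "total_on_arity k f" "total_on_arity k g"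
  shows "total_on_arity k (\<lambda>xs. prod_encode (f xs, g xs))"
  using assms unfolding prod_encode_def split
  by (intro total_on_arity_add total_on_arity_triangle)

text \<open>
  The total recursive functions of one argument and the decidable properties of numbers. A function
  of several variables is treated as a function of the code of the tuple of its arguments, so that
  the closure properties below can be applied by following the syntax of a term.
\<close>

definition recursive :: "(nat \<Rightarrow> nat) \<Rightarrow> bool" where
  "recursive f \<longleftrightarrow> total_on_arity 1 (\<lambda>xs. f (xs ! 0))"

definition decidable :: "(nat \<Rightarrow> bool) \<Rightarrow> bool" where
  "decidable P \<longleftrightarrow> recursive (\<lambda>x. if P x then 1 else 0)"

abbreviation pfst :: "nat \<Rightarrow> nat" where "pfst z \<equiv> fst (prod_decode z)"
abbreviation psnd :: "nat \<Rightarrow> nat" where "psnd z \<equiv> snd (prod_decode z)"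

lemma recursive_id: "recursive (\<lambda>x. x)"
  unfolding recursive_def by (rule total_on_arity_proj) simp

lemma recursive_const: "recursive (\<lambda>_. n)"
  unfolding recursive_def by (rule total_on_arity_const)

lemma recursive_compose: "recursive f \<Longrightarrow> recursive g \<Longrightarrow> recursive (\<lambda>x. f (g x))"
  unfolding recursive_def by (rule total_on_arity_compose1)

lemma recursive_Suc: "recursive f \<Longrightarrow> recursive (\<lambda>x. Suc (f x))"
  unfolding recursive_def by (rule total_on_arity_Suc)

lemma recursive_add: "recursive f \<Longrightarrow> recursive g \<Longrightarrow> recursive (\<lambda>x. f x + g x)"
  unfolding recursive_def by (rule total_on_arity_add)

lemma recursive_mult: "recursive f \<Longrightarrow> recursive g \<Longrightarrow> recursive (\<lambda>x. f x * g x)"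
  unfolding recursive_def by (rule total_on_arity_mult)

lemma recursive_diff: "recursive f \<Longrightarrow> recursive g \<Longrightarrow> recursive (\<lambda>x. f x - g x)"
  unfolding recursive_def by (rule total_on_arity_diff)

lemma recursive_prod_encode:
  assumes "recursive f" "recursive g"
  shows "recursive (\<lambda>x. prod_encode (f x, g x))"
  using assms unfolding recursive_def by (rule total_on_arity_prod_encode)

lemma recursive_pfst:
  assumes "recursive f"
  shows "recursive (\<lambda>x. pfst (f x))"
proof -
  have "z - triangle (pfst z + psnd z) = pfst z" for z
  proof -
    have "triangle (pfst z + psnd z) + pfst z = z"
      using prod_decode_inverse[of z] by (simp add: prod_encode_def split_beta)
    then show ?thesis by linarith
  qed
  then have "pfst (f x) = f x - triangle (pfst (f x) + psnd (f x))" for x by simp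
  moreover have "recursive (\<lambda>x. f x - triangle (pfst (f x) + psnd (f x)))"
    using assms unfolding recursive_def
    by (intro total_on_arity_diff total_on_arity_triangle total_on_arity_antidiagonal)
  ultimately show ?thesis by simp
qed

lemma recursive_psnd:
  assumes "recursive f"
  shows "recursive (\<lambda>x. psnd (f x))"
proof -
  have "recursive (\<lambda>x. (pfst (f x) + psnd (f x)) - pfst (f x))"
    using assms unfolding recursive_def
    by (intro total_on_arity_diff total_on_arity_antidiagonal
        recursive_pfst[unfolded recursive_def])
  then show ?thesis by simp
qed

text \<open>
  Definition by primitive recursion. The step \<open>g\<close> depends on the counter, on the previous value and
  on the parameter \<open>x\<close>, and is recursive as a function of the code of these three.
\<close>

lemma recursive_rec_nat:
  assumes n: "recursive n" and f: "recursive f"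
    and g: "recursive (\<lambda>z. g (pfst z) (pfst (psnd z)) (psnd (psnd z)))"
  shows "recursive (\<lambda>x. rec_nat (f x) (\<lambda>t r. g t r x) (n x))"
proof -
  let ?G = "\<lambda>z. g (pfst z) (pfst (psnd z)) (psnd (psnd z))"
  have "total_on_arity 3 (\<lambda>xs. ?G (prod_encode (xs ! 0, prod_encode (xs ! 1, xs ! 2))))"
    by (rule total_on_arity_compose1[where f = "?G", OF g[unfolded recursive_def]])
      (intro total_on_arity_prod_encode total_on_arity_proj; simp)
  then have "total_on_arity 3 (\<lambda>xs. g (xs ! 0) (xs ! 1) (xs ! 2))" by simp
  then have "total_on_arity 2 (\<lambda>xs. rec_nat (f (xs ! 1)) (\<lambda>t r. g t r (xs ! 1)) (xs ! 0))"
    using f unfolding recursive_def by (intro total_on_arity_rec2)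
  from total_on_arity_compose2[where f = "\<lambda>a b. rec_nat (f b) (\<lambda>t r. g t r b) a", OF this]
  show ?thesis using n unfolding recursive_def by (auto intro: total_on_arity_proj)
qed

lemma recursive_funpow:
  assumes "recursive f" "recursive n" "recursive a"
  shows "recursive (\<lambda>x. (f ^^ n x) (a x))"
proof -
  have "(f ^^ m) b = rec_nat b (\<lambda>t r. f r) m" for m b
    by (induction m) simp_all
  then show ?thesis
    using assms recursive_compose[OF assms(1) recursive_pfst[OF recursive_psnd[OF recursive_id]]]
    by (simp only:) (rule recursive_rec_nat)
qed

lemma decidable_not:
  assumes "decidable P"
  shows "decidable (\<lambda>x. \<not> P x)"
proof -
  have "(if \<not> P x then 1 else 0) = 1 - (if P x then 1 else 0 :: nat)" for x by simp
  then show ?thesis using assms unfolding decidable_def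
    by (simp only:) (intro recursive_diff recursive_const)
qed

lemma decidable_conj:
  assumes "decidable P" "decidable Q"
  shows "decidable (\<lambda>x. P x \<and> Q x)"
proof -
  have "(if P x \<and> Q x then 1 else 0) = (if P x then 1 else 0 :: nat) * (if Q x then 1 else 0)" for x
    by simp
  then show ?thesis using assms unfolding decidable_def by (simp only:) (intro recursive_mult)
qed

lemma decidable_disj:
  assumes "decidable P" "decidable Q"
  shows "decidable (\<lambda>x. P x \<or> Q x)"
  using decidable_not[OF decidable_conj[OF assms[THEN decidable_not]]] by simp

lemma decidable_imp:
  assumes "decidable P" "decidable Q"
  shows "decidable (\<lambda>x. P x \<longrightarrow> Q x)"
  using decidable_disj[OF decidable_not[OF assms(1)] assms(2)] by simp

lemma decidable_less:
  assumes "recursive f" "recursive g"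
  shows "decidable (\<lambda>x. f x < g x)"
proof -
  have "(if f x < g x then 1 else 0) = 1 - (1 - (g x - f x))" for x by simp
  then show ?thesis using assms unfolding decidable_def
    by (simp only:) (intro recursive_diff recursive_const)
qed

lemma decidable_le:
  assumes "recursive f" "recursive g"
  shows "decidable (\<lambda>x. f x \<le> g x)"
  using decidable_not[OF decidable_less[OF assms(2,1)]] by (simp add: not_less)

lemma decidable_eq:
  assumes "recursive f" "recursive g"
  shows "decidable (\<lambda>x. f x = g x)"
  using decidable_conj[OF decidable_le[OF assms] decidable_le[OF assms(2,1)]] by (simp add: eq_iff)

lemma recursive_if:
  assumes "decidable P" "recursive f" "recursive g"
  shows "recursive (\<lambda>x. if P x then f x else g x)"
proof -
  have "(if P x then f x else g x) =
      (if P x then 1 else 0) * f x + (if \<not> P x then 1 else 0) * g x" for x by simp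
  then show ?thesis
    using assms(2,3) assms(1)[unfolded decidable_def]
      decidable_not[OF assms(1), unfolded decidable_def]
    by (simp only:) (intro recursive_add recursive_mult)
qed

lemma decidable_compose: "decidable P \<Longrightarrow> recursive f \<Longrightarrow> decidable (\<lambda>x. P (f x))"
  unfolding decidable_def by (rule recursive_compose)

text \<open>
  The matrix of a bounded quantifier is a property of the code of the pair consisting of the bound
  variable and the parameter.
\<close>

lemma decidable_bex_less:
  assumes "recursive n" "decidable (\<lambda>z. P (pfst z) (psnd z))"
  shows "decidable (\<lambda>x. \<exists>y<n x. P y x)"
proof -
  let ?r = "\<lambda>x. rec_nat (0::nat) (\<lambda>t r. if P t x then 1 else r)"
  have "(if \<exists>y<m. P y x then 1 else 0) = ?r x m" for m x
  proof (induction m)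
    case (Suc m)
    have "(\<exists>y<Suc m. P y x) \<longleftrightarrow> P m x \<or> (\<exists>y<m. P y x)" by (auto simp: less_Suc_eq)
    then show ?case using Suc by (simp del: One_nat_def)
  qed simp
  moreover have "decidable (\<lambda>z. P (pfst z) (psnd (psnd z)))"
    using decidable_compose[OF assms(2) recursive_prod_encode[OF recursive_pfst[OF recursive_id]
      recursive_psnd[OF recursive_psnd[OF recursive_id]]]] by simp
  then have "recursive (\<lambda>x. ?r x (n x))"
    by (intro recursive_rec_nat[where g = "\<lambda>t r x. if P t x then 1 else r"] recursive_if
        recursive_const recursive_pfst recursive_psnd recursive_id assms(1))
  ultimately show ?thesis unfolding decidable_def by simp
qed

lemma decidable_ball_less:
  assumes "recursive n" "decidable (\<lambda>z. P (pfst z) (psnd z))"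
  shows "decidable (\<lambda>x. \<forall>y<n x. P y x)"
  using decidable_not[OF decidable_bex_less[OF assms(1) decidable_not[OF assms(2)]]] by simp

lemma decidable_rel3:
  assumes "computable_rel 3 R" "recursive f" "recursive g" "recursive h"
  shows "decidable (\<lambda>x. R [f x, g x, h x])"
proof -
  have "total_on_arity 3 (\<lambda>xs. if R xs then 1 else 0)"
    using assms(1) unfolding computable_rel_def total_on_arity_def .
  from total_on_arity_compose3[OF this assms(2-)[unfolded recursive_def]]
  show ?thesis unfolding decidable_def recursive_def .
qed

lemma decidable_imp_computable_rel3:
  assumes "decidable (\<lambda>z. P (pfst z) (pfst (psnd z)) (psnd (psnd z)))"
  shows "computable_rel 3 (\<lambda>xs. P (xs ! 0) (xs ! 1) (xs ! 2))"
proof -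
  let ?F = "\<lambda>z. if P (pfst z) (pfst (psnd z)) (psnd (psnd z)) then 1 else 0 :: nat"
  have "total_on_arity 3 (\<lambda>xs. ?F (prod_encode (xs ! 0, prod_encode (xs ! 1, xs ! 2))))"
    using assms unfolding decidable_def recursive_def
    by (rule total_on_arity_compose1[where f = ?F])
      (intro total_on_arity_prod_encode total_on_arity_proj; simp)
  then show ?thesis unfolding total_on_arity_def computable_rel_def by simp
qed

section \<open>Recursive operations on coded lists\<close>

text \<open>
  The operations that \<^const>\<open>list_decode\<close> turns into the usual ones on lists. They are total: the
  tail of the empty list is empty, and entries beyond the length are \<open>0\<close>.
\<close>

abbreviation code_Cons :: "nat \<Rightarrow> nat \<Rightarrow> nat" where
  "code_Cons x a \<equiv> Suc (prod_encode (x, a))"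

definition code_tl :: "nat \<Rightarrow> nat" where
  "code_tl a = psnd (a - 1)"

definition code_nth :: "nat \<Rightarrow> nat \<Rightarrow> nat" where
  "code_nth a i = pfst ((code_tl ^^ i) a - 1)"

lemma list_decode_code_tl: "list_decode (code_tl a) = tl (list_decode a)"
proof (cases a)
  case 0
  have "prod_decode 0 = (0, 0)" by (simp add: prod_decode_def prod_decode_aux.simps)
  then show ?thesis using 0 by (simp add: code_tl_def)
next
  case (Suc m)
  then show ?thesis by (cases "prod_decode m") (simp add: code_tl_def)
qed

lemma list_decode_code_drop: "list_decode ((code_tl ^^ i) a) = drop i (list_decode a)"
  by (induction i) (simp_all add: list_decode_code_tl drop_Suc tl_drop)

lemma code_nth_eq:
  assumes "i < length (list_decode a)"
  shows "code_nth a i = list_decode a ! i"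
proof -
  let ?b = "(code_tl ^^ i) a"
  have b: "list_decode ?b = drop i (list_decode a)" by (rule list_decode_code_drop)
  with assms obtain m where m: "?b = Suc m" by (cases ?b) auto
  then have "list_decode ?b ! 0 = pfst m" by (cases "prod_decode m") simp
  with b m assms show ?thesis by (simp add: code_nth_def)
qed

lemma length_list_decode_le: "length (list_decode a) \<le> a"
proof -
  have "length xs \<le> list_encode xs" for xs
  proof (induction xs)
    case (Cons x xs)
    then show ?case using le_prod_encode_2[of "list_encode xs" x] by simp
  qed simp
  from this[of "list_decode a"] show ?thesis by simp
qed

lemma recursive_code_tl: "recursive f \<Longrightarrow> recursive (\<lambda>x. code_tl (f x))"
  unfolding code_tl_def by (intro recursive_psnd recursive_diff recursive_const)

lemma recursive_code_drop:
  "recursive f \<Longrightarrow> recursive n \<Longrightarrow> recursive (\<lambda>x. (code_tl ^^ n x) (f x))"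
  by (rule recursive_funpow) (rule recursive_code_tl[OF recursive_id])

lemma recursive_code_nth:
  "recursive f \<Longrightarrow> recursive n \<Longrightarrow> recursive (\<lambda>x. code_nth (f x) (n x))"
  unfolding code_nth_def
  by (intro recursive_pfst recursive_diff recursive_const recursive_code_drop)

lemma recursive_length:
  assumes "recursive f"
  shows "recursive (\<lambda>x. length (list_decode (f x)))"
proof -
  let ?r = "\<lambda>a. rec_nat 0 (\<lambda>t r. if (code_tl ^^ t) a = 0 then r else Suc r)"
  have zero: "b = 0 \<longleftrightarrow> list_decode b = []" for b
    by (metis list_decode.simps(1) list_decode_inverse list_encode.simps(1))
  \<comment> \<open>Count the nonempty iterated tails; the code of a list bounds its length.\<close>
  have "?r a m = min m (length (list_decode a))" for a m
    by (induction m) (auto simp: zero list_decode_code_drop)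
  then have "?r (f x) (f x) = length (list_decode (f x))" for x
    using length_list_decode_le[of "f x"] by simp
  moreover have "recursive (\<lambda>x. ?r (f x) (f x))"
  proof (rule recursive_rec_nat[OF assms recursive_const])
    have "recursive (\<lambda>z. f (psnd (psnd z)))"
      by (intro recursive_compose[OF assms] recursive_psnd recursive_id)
    then show "recursive (\<lambda>z. if (code_tl ^^ pfst z) (f (psnd (psnd z))) = 0 then pfst (psnd z)
        else Suc (pfst (psnd z)))"
      by (intro recursive_if decidable_eq recursive_const recursive_Suc recursive_pfst
          recursive_psnd recursive_id recursive_code_drop)
  qed
  ultimately show ?thesis by simp
qed

lemmas recursive_intros =
  recursive_id recursive_const recursive_Suc recursive_add recursive_mult recursive_diff
  recursive_prod_encode recursive_pfst recursive_psnd recursive_code_tl recursive_code_drop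
  recursive_code_nth recursive_length

lemmas decidable_intros =
  decidable_not decidable_conj decidable_disj decidable_imp decidable_less
  decidable_le decidable_eq decidable_bex_less decidable_ball_less

lemma decidable_mem:
  assumes "recursive f" "recursive d"
  shows "decidable (\<lambda>x. f x \<in> set (list_decode (d x)))"
proof -
  have "f x \<in> set (list_decode (d x)) \<longleftrightarrow>
      (\<exists>i<length (list_decode (d x)). code_nth (d x) i = f x)" for x
    by (auto simp: in_set_conv_nth code_nth_eq)
  then show ?thesis
    using recursive_compose[OF assms(1) recursive_psnd[OF recursive_id]]
      recursive_compose[OF assms(2) recursive_psnd[OF recursive_id]] assms
    by (simp only:) (intro decidable_intros recursive_intros)
qed

section \<open>Derivations of values of partial recursive functions\<close>

lemma inv_encode_encode [simp]: "inv encode (encode f) = f"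
  using bij_encode by (simp add: bij_is_inj)

lemma encode_inv_encode [simp]: "encode (inv encode n) = n"
  using bij_encode by (simp add: bij_is_surj surj_f_inv_f)

lemma inv_encode_eq: "encode f = n \<Longrightarrow> inv encode n = f"
  by auto

lemma inv_encode_Comp: "inv encode (4 * prod_encode (f, gs) + 3) =
    Comp (inv encode f) (map (inv encode) (list_decode gs))"
  by (rule inv_encode_eq) (simp add: o_def)

lemma inv_encode_PrimRec:
  "inv encode (4 * prod_encode (f, g) + 4) = PrimRec (inv encode f) (inv encode g)"
  by (rule inv_encode_eq) simp

lemma inv_encode_Mu: "inv encode (4 * f + 5) = Mu (inv encode f)"
  by (rule inv_encode_eq) simp

text \<open>
  One step of the evaluation of a term. Read \<open>S f b r\<close> as the statement, already established, that
  the term with code \<open>f\<close> has the value \<open>r\<close> at the arguments coded by \<open>b\<close>. Then \<open>eval_step S c a v\<close>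
  holds if such statements give the value \<open>v\<close> to the term with code \<open>c\<close> at the arguments coded by
  \<open>a\<close>. The six disjuncts follow the six constructors of terms.
\<close>

definition eval_step :: "(nat \<Rightarrow> nat \<Rightarrow> nat \<Rightarrow> bool) \<Rightarrow> nat \<Rightarrow> nat \<Rightarrow> nat \<Rightarrow> bool" where
  "eval_step S c a v \<longleftrightarrow>
    c = 0 \<and> v = 0 \<or>
    c = 1 \<and> 0 < length (list_decode a) \<and> v = Suc (code_nth a 0) \<or>
    (\<exists>i. c = 4 * i + 2 \<and> i < length (list_decode a) \<and> v = code_nth a i) \<or>
    (\<exists>f gs. c = 4 * prod_encode (f, gs) + 3 \<and>
      (\<exists>b. length (list_decode b) = length (list_decode gs) \<and> S f b v \<and>
        (\<forall>j<length (list_decode gs). S (code_nth gs j) a (code_nth b j)))) \<or>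
    (\<exists>f g. c = 4 * prod_encode (f, g) + 4 \<and> 0 < length (list_decode a) \<and>
      (if code_nth a 0 = 0 then S f (code_tl a) v
       else \<exists>r. S c (code_Cons (code_nth a 0 - 1) (code_tl a)) r \<and>
         S g (code_Cons (code_nth a 0 - 1) (code_Cons r (code_tl a))) v)) \<or>
    (\<exists>f. c = 4 * f + 5 \<and> S f (code_Cons v a) 0 \<and>
      (\<forall>z<v. \<exists>r. 0 < r \<and> S f (code_Cons z a) r))"

lemma eval_step_mono:
  assumes "eval_step S c a v" "\<And>c a v. S c a v \<Longrightarrow> S' c a v"
  shows "eval_step S' c a v"
proof -
  have S: "S c a v \<longrightarrow> S' c a v" for c a v using assms(2) by blast
  have "eval_step S c a v \<longrightarrow> eval_step S' c a v"
    unfolding eval_step_def if_bool_eq_conj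
    by (intro disj_mono ex_mono conj_mono all_mono imp_mono imp_refl S)
  then show ?thesis using assms(1) ..
qed

text \<open>
  The meaning of the statement about \<open>c\<close>, \<open>a\<close> and \<open>v\<close>.
\<close>

abbreviation evaluates :: "nat \<Rightarrow> nat \<Rightarrow> nat \<Rightarrow> bool" where
  "evaluates c a v \<equiv> eval (inv encode c) (list_decode a) = Some v"

lemma eval_step_sound:
  assumes "eval_step S c a v" "\<And>c a v. S c a v \<Longrightarrow> evaluates c a v"
  shows "evaluates c a v"
  using assms(1) unfolding eval_step_def
proof (elim disjE exE conjE)
  assume "c = 0" "v = 0"
  then show ?thesis by (simp add: inv_encode_eq[of Zero])
next
  assume "c = 1" "0 < length (list_decode a)" "v = Suc (code_nth a 0)"
  then show ?thesis
    by (cases "list_decode a") (simp_all add: inv_encode_eq[of Succ] code_nth_eq)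
next
  fix i assume "c = 4 * i + 2" "i < length (list_decode a)" "v = code_nth a i"
  then show ?thesis
    by (simp add: inv_encode_eq[of "Proj i"] code_nth_eq)
next
  fix f gs b
  assume c: "c = 4 * prod_encode (f, gs) + 3"
    and l: "length (list_decode b) = length (list_decode gs)"
    and f: "S f b v" and g: "\<forall>j<length (list_decode gs). S (code_nth gs j) a (code_nth b j)"
  have g': "eval (inv encode (list_decode gs ! j)) (list_decode a) = Some (list_decode b ! j)"
    if "j < length (list_decode gs)" for j
    using g assms(2) that l by (metis code_nth_eq)
  have "map (\<lambda>g. the (eval g (list_decode a))) (map (inv encode) (list_decode gs)) = list_decode b"
    by (rule nth_equalityI) (simp_all add: l g')
  moreover have "\<forall>g\<in>set (map (inv encode) (list_decode gs)). eval g (list_decode a) \<noteq> None"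
    using g' by (auto simp: in_set_conv_nth)
  ultimately show ?thesis using assms(2)[OF f]
    unfolding c inv_encode_Comp eval.simps by (simp del: map_map)
next
  fix f g
  assume c: "c = 4 * prod_encode (f, g) + 4" and a: "0 < length (list_decode a)"
    and S: "if code_nth a 0 = 0 then S f (code_tl a) v
       else \<exists>r. S c (code_Cons (code_nth a 0 - 1) (code_tl a)) r \<and>
         S g (code_Cons (code_nth a 0 - 1) (code_Cons r (code_tl a))) v"
  obtain x ys where xs: "list_decode a = x # ys" using a by (cases "list_decode a") auto
  then have x: "code_nth a 0 = x" and ys: "list_decode (code_tl a) = ys"
    by (simp_all add: code_nth_eq list_decode_code_tl)
  show ?thesis
  proof (cases x)
    case 0
    then have "evaluates f (code_tl a) v" using S x assms(2) by simp
    then show ?thesis using 0 xs ys unfolding c inv_encode_PrimRec by simp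
  next
    case (Suc t)
    then obtain r where "S c (code_Cons t (code_tl a)) r"
      "S g (code_Cons t (code_Cons r (code_tl a))) v"
      using S x by auto
    from this[THEN assms(2)] show ?thesis using Suc xs ys unfolding c inv_encode_PrimRec by simp
  qed
next
  fix f assume c: "c = 4 * f + 5" and f: "S f (code_Cons v a) 0"
    and z: "\<forall>z<v. \<exists>r. 0 < r \<and> S f (code_Cons z a) r"
  let ?e = "\<lambda>y. eval (inv encode f) (y # list_decode a)"
  have v0: "?e v = Some 0" using assms(2)[OF f] by simp
  have pos: "\<exists>r>0. ?e y = Some r" if "y < v" for y
    using z that assms(2)[of f "code_Cons y a"] by force
  have "(LEAST y. ?e y = Some 0) = v"
  proof (rule Least_equality)
    fix y assume "?e y = Some 0"
    then show "v \<le> y" using pos[of y] by (cases "y < v") auto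
  qed (rule v0)
  moreover have "\<exists>y. ?e y = Some 0 \<and> (\<forall>z<y. ?e z \<noteq> None)" using v0 pos by blast
  ultimately show ?thesis unfolding c inv_encode_Mu eval.simps by simp
qed

text \<open>
  The code of the statement that the term with code \<open>c\<close> has the value \<open>v\<close> at the arguments coded
  by \<open>a\<close>.
\<close>

definition triple :: "nat \<Rightarrow> nat \<Rightarrow> nat \<Rightarrow> nat" where
  "triple c a v = prod_encode (c, prod_encode (a, v))"

definition concludes :: "nat list \<Rightarrow> nat \<Rightarrow> nat \<Rightarrow> nat \<Rightarrow> bool" where
  "concludes L c a v \<longleftrightarrow> triple c a v \<in> set L"

text \<open>
  A derivation is a list of codes of statements each of which follows in one step from the statements
  after it, so that the head is the last conclusion.
\<close>

fun derivation :: "nat list \<Rightarrow> bool" where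
  "derivation [] \<longleftrightarrow> True"
| "derivation (e # L) \<longleftrightarrow>
    eval_step (concludes L) (pfst e) (pfst (psnd e)) (psnd (psnd e)) \<and> derivation L"

lemma triple_eq_iff: "triple c a v = e \<longleftrightarrow> c = pfst e \<and> a = pfst (psnd e) \<and> v = psnd (psnd e)"
  unfolding triple_def by (auto simp: prod_encode_eq)

lemma derivation_sound: "derivation L \<Longrightarrow> concludes L c a v \<Longrightarrow> evaluates c a v"
proof (induction L arbitrary: c a v)
  case Nil
  then show ?case by (simp add: concludes_def)
next
  case (Cons e L)
  show ?case
  proof (cases "concludes L c a v")
    case True
    then show ?thesis using Cons by simp
  next
    case False
    then have "triple c a v = e" using Cons.prems(2) by (simp add: concludes_def)
    then have "eval_step (concludes L) c a v" using Cons.prems(1) by (simp add: triple_eq_iff)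
    then show ?thesis by (rule eval_step_sound) (use Cons in simp)
  qed
qed

lemma derivation_append:
  assumes "derivation L" "derivation M"
  shows "derivation (L @ M)"
  using assms(1)
proof (induction L)
  case (Cons e L)
  then show ?case by (auto simp: concludes_def intro: eval_step_mono)
qed (simp add: assms(2))

definition derivable :: "nat \<Rightarrow> nat \<Rightarrow> nat \<Rightarrow> bool" where
  "derivable c a v \<longleftrightarrow> (\<exists>L. derivation L \<and> concludes L c a v)"

text \<open>
  Derivations can be concatenated, so finitely many derivable statements occur in one derivation.
\<close>

lemma finite_derivable_common_derivation:
  assumes "finite T" "\<forall>(c, a, v)\<in>T. derivable c a v"
  shows "\<exists>L. derivation L \<and> (\<forall>(c, a, v)\<in>T. concludes L c a v)"
  using assms
proof (induction T rule: finite_induct)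
  case empty
  then show ?case by (intro exI[of _ "[]"]) simp
next
  case (insert t T)
  obtain c a v where t: "t = (c, a, v)" by (cases t)
  from insert obtain L where L: "derivation L" "\<forall>(c, a, v)\<in>T. concludes L c a v" by auto
  from insert.prems t obtain M where M: "derivation M" "concludes M c a v"
    by (auto simp: derivable_def)
  then show ?case using L t
    by (intro exI[of _ "M @ L"]) (auto simp: derivation_append concludes_def)
qed

lemma derivable_step:
  assumes "finite T" "\<forall>(c, a, v)\<in>T. derivable c a v" "eval_step (\<lambda>c a v. (c, a, v) \<in> T) c a v"
  shows "derivable c a v"
proof -
  obtain L where L: "derivation L" "\<forall>(c, a, v)\<in>T. concludes L c a v"
    using finite_derivable_common_derivation[OF assms(1,2)] by blast
  then have "eval_step (concludes L) c a v"
    by (intro eval_step_mono[OF assms(3)]) auto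
  then have "derivation (triple c a v # L)" using L(1) by (simp add: triple_def)
  then show ?thesis
    unfolding derivable_def concludes_def by (intro exI[of _ "triple c a v # L"]) simp
qed

text \<open>
  Every defined value has a derivation, by induction on the term. Each case names the finite set of
  statements from which the last step concludes.
\<close>

lemma derivable_complete: "eval f xs = Some v \<Longrightarrow> derivable (encode f) (list_encode xs) v"
proof (induction f arbitrary: xs v)
  case Zero
  then show ?case by (intro derivable_step[of "{}"]) (simp_all add: eval_step_def)
next
  case Succ
  then show ?case
    by (intro derivable_step[of "{}"])
      (auto simp: eval_step_def code_nth_eq split: list.splits simp del: list_encode.simps)
next
  case (Proj i)
  then show ?case
    by (intro derivable_step[of "{}"])
      (auto simp: eval_step_def code_nth_eq split: if_splits)
next
  case (Comp f gs)
  define ys where "ys = map (\<lambda>g. the (eval g xs)) gs"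
  have g: "eval g xs = Some (the (eval g xs))" if "g \<in> set gs" for g
    using Comp.prems that by (auto split: if_splits)
  have f: "eval f ys = Some v" using Comp.prems unfolding ys_def by (auto split: if_splits)
  let ?T = "insert (encode f, list_encode ys, v)
    ((\<lambda>g. (encode g, list_encode xs, the (eval g xs))) ` set gs)"
  have "\<forall>(c, a, v)\<in>?T. derivable c a v"
    using Comp.IH(1)[OF f] Comp.IH(2)[OF _ g] by auto
  moreover have "eval_step (\<lambda>c a v. (c, a, v) \<in> ?T) (encode (Comp f gs)) (list_encode xs) v"
    unfolding eval_step_def
    by (rule disjI2, rule disjI2, rule disjI2, rule disjI1)
      (rule exI[of _ "encode f"], rule exI[of _ "list_encode (map encode gs)"],
        auto intro!: exI[of _ "list_encode ys"] simp: code_nth_eq ys_def)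
  ultimately show ?case by (rule derivable_step[rotated]) simp
next
  case (PrimRec f g)
  let ?c = "encode (PrimRec f g)"
  obtain x ys where xs: "xs = x # ys" using PrimRec.prems by (cases xs) auto
  have nth: "code_nth (list_encode (y # ys)) 0 = y" for y
    using code_nth_eq[of 0 "list_encode (y # ys)"] by (simp del: list_encode.simps)
  have tl: "code_tl (list_encode (y # ys)) = list_encode ys" for y
    by (simp add: code_tl_def)
  have len: "0 < length (list_decode (list_encode (y # ys)))" for y
    by (simp del: list_encode.simps)
  have "eval (PrimRec f g) (x # ys) = Some v \<Longrightarrow> derivable ?c (list_encode (x # ys)) v" for v
  proof (induction x arbitrary: v)
    case 0
    let ?T = "{(encode f, list_encode ys, v)}"
    have "eval f ys = Some v" using 0 by simp
    then have "\<forall>(c, a, v)\<in>?T. derivable c a v" using PrimRec.IH(1) by simp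
    moreover have "eval_step (\<lambda>c a v. (c, a, v) \<in> ?T) ?c (list_encode (0 # ys)) v"
      unfolding eval_step_def nth tl
      by (rule disjI2, rule disjI2, rule disjI2, rule disjI2, rule disjI1)
        (rule exI[of _ "encode f"], rule exI[of _ "encode g"],
          use len in \<open>simp del: list_encode.simps\<close>)
    ultimately show ?case by (rule derivable_step[rotated]) simp
  next
    case (Suc t)
    obtain r where r: "eval (PrimRec f g) (t # ys) = Some r" "eval g (t # r # ys) = Some v"
      using Suc.prems by (auto simp: bind_eq_Some_conv)
    let ?T = "{(?c, list_encode (t # ys), r), (encode g, list_encode (t # r # ys), v)}"
    have "\<forall>(c, a, v)\<in>?T. derivable c a v"
      using Suc.IH[OF r(1)] PrimRec.IH(2)[OF r(2)] by auto
    moreover have "eval_step (\<lambda>c a v. (c, a, v) \<in> ?T) ?c (list_encode (Suc t # ys)) v"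
      unfolding eval_step_def nth tl
      by (rule disjI2, rule disjI2, rule disjI2, rule disjI2, rule disjI1)
        (rule exI[of _ "encode f"], rule exI[of _ "encode g"],
          use len[of "Suc t"] in \<open>auto intro!: exI[of _ r]\<close>)
    ultimately show ?case by (rule derivable_step[rotated]) simp
  qed
  then show ?case using PrimRec.prems unfolding xs by blast
next
  case (Mu f)
  let ?P = "\<lambda>y. eval f (y # xs) = Some 0 \<and> (\<forall>z<y. eval f (z # xs) \<noteq> None)"
  from Mu.prems have ex: "\<exists>y. ?P y" and v: "v = (LEAST y. eval f (y # xs) = Some 0)"
    by (auto split: if_splits)
  then obtain y where y: "?P y" by blast
  have v0: "eval f (v # xs) = Some 0" unfolding v using y by (metis (mono_tags) LeastI)
  have "v \<le> y" unfolding v using y by (simp add: Least_le)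
  have pos: "\<exists>r>0. eval f (z # xs) = Some r" if zv: "z < v" for z
  proof -
    have "eval f (z # xs) \<noteq> None" using y \<open>v \<le> y\<close> zv by auto
    then obtain r where "eval f (z # xs) = Some r" by blast
    moreover have "r \<noteq> 0" using calculation zv not_less_Least unfolding v by metis
    ultimately show ?thesis by blast
  qed
  let ?T = "insert (encode f, list_encode (v # xs), 0)
    ((\<lambda>z. (encode f, list_encode (z # xs), the (eval f (z # xs)))) ` {..<v})"
  have T: "\<forall>(c, a, v)\<in>?T. derivable c a v"
    using Mu.IH v0 pos by fastforce
  have exr: "\<exists>r>0. (encode f, code_Cons z (list_encode xs), r) \<in> ?T" if "z < v" for z
    using pos[OF that] that by (intro exI[of _ "the (eval f (z # xs))"]) auto
  have "eval_step (\<lambda>c a v. (c, a, v) \<in> ?T) (encode (Mu f)) (list_encode xs) v"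
    unfolding eval_step_def
    by (intro disjI2, rule exI[of _ "encode f"], intro conjI allI impI)
      (simp, simp, rule exr)
  with T show ?case by (rule derivable_step[rotated]) simp
qed

text \<open>
  Kleene's normal form: \<open>\<phi>\<^sub>n(x) = v\<close> is an existential statement about derivations. The number
  \<open>code_Cons x 0\<close> codes the list whose only entry is \<open>x\<close>.
\<close>

lemma phi_eq_Some_iff:
  "phi n x = Some v \<longleftrightarrow>
    (\<exists>d. derivation (list_decode d) \<and> concludes (list_decode d) n (code_Cons x 0) v)"
proof
  assume "phi n x = Some v"
  then have "derivable n (code_Cons x 0) v"
    using derivable_complete[of "inv encode n" "[x]" v] unfolding phi_def by simp
  then show "\<exists>d. derivation (list_decode d) \<and> concludes (list_decode d) n (code_Cons x 0) v"
    unfolding derivable_def by (metis list_encode_inverse)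
next
  assume "\<exists>d. derivation (list_decode d) \<and> concludes (list_decode d) n (code_Cons x 0) v"
  then show "phi n x = Some v"
    using derivation_sound[of _ n "code_Cons x 0" v] unfolding phi_def by auto
qed

lemma phi_agrees_common_derivation:
  assumes "\<forall>i<N. phi n i = Some (f i)"
  shows "\<exists>d. derivation (list_decode d) \<and>
    (\<forall>i<N. concludes (list_decode d) n (code_Cons i 0) (f i))"
proof -
  have "\<exists>L. derivation L \<and> (\<forall>(c, a, v)\<in>(\<lambda>i. (n, code_Cons i 0, f i)) ` {..<N}. concludes L c a v)"
    using assms by (intro finite_derivable_common_derivation)
      (auto simp: phi_eq_Some_iff derivable_def)
  then obtain L where "derivation L" "\<forall>i<N. concludes L n (code_Cons i 0) (f i)" by auto
  then show ?thesis by (intro exI[of _ "list_encode L"]) simp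
qed

lemma decidable_concludes:
  assumes "recursive d" "recursive c" "recursive a" "recursive v"
  shows "decidable (\<lambda>x. concludes (list_decode (d x)) (c x) (a x) (v x))"
  unfolding concludes_def triple_def by (intro decidable_mem recursive_intros assms)

lemma concludes_less:
  assumes "concludes (list_decode d) c a v"
  shows "a < d" "v < d"
  using list_decode_less[of "triple c a v" d] assms
    le_prod_encode_1[of c "prod_encode (a, v)"] le_prod_encode_2[of "prod_encode (a, v)" c]
    le_prod_encode_1[of a v] le_prod_encode_2[of v a]
  unfolding concludes_def triple_def by linarith+

text \<open>
  All quantifiers in a step can be bounded if the arguments and values in the statements \<open>S\<close> have codes
  below \<open>d\<close>. For the statements that occur in a derivation with code \<open>d\<close> this is the case, and
  therefore it is decidable whether a number codes a derivation.
\<close>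

lemma eval_step_bounded:
  assumes S: "\<forall>c a v. S c a v \<longrightarrow> a < d \<and> v < d"
  shows "eval_step S c a v \<longleftrightarrow>
    c = 0 \<and> v = 0 \<or>
    c = 1 \<and> 0 < length (list_decode a) \<and> v = Suc (code_nth a 0) \<or>
    (\<exists>i<c. c = 4 * i + 2 \<and> i < length (list_decode a) \<and> v = code_nth a i) \<or>
    (\<exists>f<c. \<exists>gs<c. c = 4 * prod_encode (f, gs) + 3 \<and>
      (\<exists>b<d. length (list_decode b) = length (list_decode gs) \<and> S f b v \<and>
        (\<forall>j<length (list_decode gs). S (code_nth gs j) a (code_nth b j)))) \<or>
    (\<exists>f<c. \<exists>g<c. c = 4 * prod_encode (f, g) + 4 \<and> 0 < length (list_decode a) \<and>
      (code_nth a 0 = 0 \<longrightarrow> S f (code_tl a) v) \<and>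
      (code_nth a 0 \<noteq> 0 \<longrightarrow>
       (\<exists>r<d. S c (code_Cons (code_nth a 0 - 1) (code_tl a)) r \<and>
         S g (code_Cons (code_nth a 0 - 1) (code_Cons r (code_tl a))) v))) \<or>
    (\<exists>f<c. c = 4 * f + 5 \<and> S f (code_Cons v a) 0 \<and>
      (\<forall>z<v. \<exists>r<d. 0 < r \<and> S f (code_Cons z a) r))"
proof -
  have ex_c: "(\<exists>f g. c = 4 * prod_encode (f, g) + k \<and> Q f g) \<longleftrightarrow>
      (\<exists>f<c. \<exists>g<c. c = 4 * prod_encode (f, g) + k \<and> Q f g)" if "0 < k" for Q k
  proof -
    have "f < c \<and> g < c" if "c = 4 * prod_encode (f, g) + k" for f g
      using le_prod_encode_1[of f g] le_prod_encode_2[of g f] that \<open>0 < k\<close> by linarith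
    then show ?thesis by blast
  qed
  have ex_c1: "(\<exists>f. c = 4 * f + k \<and> Q f) \<longleftrightarrow> (\<exists>f<c. c = 4 * f + k \<and> Q f)" if "0 < k" for Q k
    using that by fastforce
  have ex_d: "(\<exists>b. P b \<and> S f b v \<and> Q b) \<longleftrightarrow> (\<exists>b<d. P b \<and> S f b v \<and> Q b)" for P Q f v
    using S by blast
  have ex_r: "(\<exists>r. S f b r \<and> Q r) \<longleftrightarrow> (\<exists>r<d. S f b r \<and> Q r)" for f b Q
    using S by blast
  have ex_r0: "(\<exists>r. 0 < r \<and> S f b r) \<longleftrightarrow> (\<exists>r<d. 0 < r \<and> S f b r)" for f b
    using S by blast
  show ?thesis
    unfolding eval_step_def ex_c[OF zero_less_numeral] ex_c1[OF zero_less_numeral] ex_d ex_r ex_r0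
      if_bool_eq_conj ..
qed

lemma decidable_eval_step:
  assumes "recursive d" "recursive c" "recursive a" "recursive v"
  shows "decidable (\<lambda>x. eval_step (concludes (list_decode (d x))) (c x) (a x) (v x))"
proof -
  let ?P = "\<lambda>d c a v. eval_step (concludes (list_decode d)) c a v"
  have "\<forall>c a v. concludes (list_decode d) c a v \<longrightarrow> a < d \<and> v < d" for d
    using concludes_less by blast
  note bounded = eval_step_bounded[OF this]
  have "decidable (\<lambda>z. ?P (pfst (pfst z)) (psnd (pfst z)) (pfst (psnd z)) (psnd (psnd z)))"
    unfolding bounded
    by (intro decidable_intros decidable_concludes recursive_intros)
  from decidable_compose[OF this,
      of "\<lambda>x. prod_encode (prod_encode (d x, c x), prod_encode (a x, v x))"]
  show ?thesis using assms by (simp add: recursive_intros)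
qed

lemma derivation_conv_nth:
  "derivation L \<longleftrightarrow> (\<forall>j<length L. eval_step (concludes (drop (Suc j) L))
     (pfst (L ! j)) (pfst (psnd (L ! j))) (psnd (psnd (L ! j))))"
  by (induction L) (simp_all add: All_less_Suc2)

lemma decidable_derivation:
  assumes "recursive d"
  shows "decidable (\<lambda>x. derivation (list_decode (d x)))"
proof -
  have "derivation (list_decode n) \<longleftrightarrow> (\<forall>j<length (list_decode n).
      eval_step (concludes (list_decode ((code_tl ^^ Suc j) n)))
        (pfst (code_nth n j)) (pfst (psnd (code_nth n j))) (psnd (psnd (code_nth n j))))" for n
    unfolding derivation_conv_nth list_decode_code_drop by (simp add: code_nth_eq)
  then have "decidable (\<lambda>n. derivation (list_decode n))"
    by (simp only:) (intro decidable_intros decidable_eval_step recursive_intros)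
  from decidable_compose[OF this assms] show ?thesis .
qed

section \<open>Signed binary expansions\<close>

text \<open>
  The partial sum of the first \<open>N\<close> terms of the series \<^term>\<open>real_of f\<close>.
\<close>

definition digit_sum :: "(nat \<Rightarrow> nat) \<Rightarrow> nat \<Rightarrow> real" where
  "digit_sum f N = (\<Sum>i<N. (real (f i) - 1) / 2 ^ (i + 1))"

lemma digit_sum_0 [simp]: "digit_sum f 0 = 0"
  by (simp add: digit_sum_def)

lemma digit_sum_Suc: "digit_sum f (Suc N) = digit_sum f N + (real (f N) - 1) / 2 ^ Suc N"
  by (simp add: digit_sum_def)

lemma digit_bound:
  assumes "range f \<subseteq> {0, 1, 2}"
  shows "\<bar>real (f i) - 1\<bar> \<le> 1"
proof -
  have "f i \<in> {0, 1, 2}" using assms by blast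
  then show ?thesis by auto
qed

lemma summable_digits:
  assumes "range f \<subseteq> {0, 1, 2}"
  shows "summable (\<lambda>i. (real (f i) - 1) / 2 ^ (i + 1))"
proof (rule summable_comparison_test)
  show "\<exists>N. \<forall>n\<ge>N. norm ((real (f n) - 1) / 2 ^ (n + 1)) \<le> (1 / 2) ^ Suc n"
    using digit_bound[OF assms] by (auto simp: power_one_over divide_simps)
  show "summable (\<lambda>n. (1 / 2 :: real) ^ Suc n)"
    using power_half_series by (rule sums_summable)
qed

lemma real_of_tail:
  assumes "range f \<subseteq> {0, 1, 2}"
  shows "real_of f - digit_sum f N = (\<Sum>i. (real (f (i + N)) - 1) / 2 ^ (i + N + 1))"
  using suminf_minus_initial_segment[OF summable_digits[OF assms], of N]
  unfolding real_of_def digit_sum_def by simp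

lemma half_powers_tail: "(\<lambda>i. c / 2 ^ (i + N + 1)) sums (c / 2 ^ N :: real)"
  using sums_mult[OF power_half_series, of "c / 2 ^ N"]
  by (simp add: power_one_over power_add field_simps)

lemma real_of_tail_bound:
  assumes "range f \<subseteq> {0, 1, 2}"
  shows "\<bar>real_of f - digit_sum f N\<bar> \<le> 1 / 2 ^ N"
proof -
  have le: "norm ((real (f (i + N)) - 1) / 2 ^ (i + N + 1)) \<le> 1 / 2 ^ (i + N + 1)" for i
    using digit_bound[OF assms, of "i + N"] by (simp add: divide_simps)
  have "norm (\<Sum>i. (real (f (i + N)) - 1) / 2 ^ (i + N + 1)) \<le> (\<Sum>i. 1 / 2 ^ (i + N + 1))"
    by (rule norm_suminf_le[OF le]) (rule sums_summable[OF half_powers_tail])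
  then show ?thesis
    unfolding real_of_tail[OF assms] using sums_unique[OF half_powers_tail[of 1 N]] by simp
qed

lemma real_of_tail_const:
  assumes "range f \<subseteq> {0, 1, 2}" "\<And>i. i \<ge> N \<Longrightarrow> f i = c"
  shows "real_of f - digit_sum f N = (real c - 1) / 2 ^ N"
  unfolding real_of_tail[OF assms(1)]
  using sums_unique[OF half_powers_tail[of "real c - 1" N]] assms(2) by simp

text \<open>
  A tail of the expansion has the largest possible absolute value only if all its digits are extremal:
  each digit must contribute its maximum, and the remaining tail must be extremal again.
\<close>

lemma extremal_tail_imp_const:
  assumes f: "range f \<subseteq> {0, 1, 2}" and s: "\<bar>s\<bar> = 1"
    and tail: "real_of f - digit_sum f N = s / 2 ^ N" and "N \<le> i"
  shows "real (f i) = 1 + s"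
proof -
  have step: "real (f M) = 1 + s \<and> real_of f - digit_sum f (Suc M) = s / 2 ^ Suc M"
    if M: "real_of f - digit_sum f M = s / 2 ^ M" for M
  proof -
    \<comment> \<open>The next tail, scaled to the interval from \<open>-1\<close> to \<open>1\<close>.\<close>
    define t where "t = (real_of f - digit_sum f (Suc M)) * 2 ^ Suc M"
    have "\<bar>t\<bar> \<le> 1"
      using real_of_tail_bound[OF f, of "Suc M"] unfolding t_def abs_mult
      by (simp add: field_simps)
    moreover have "t = (s / 2 ^ M - (real (f M) - 1) / 2 ^ Suc M) * 2 ^ Suc M"
      unfolding t_def M[symmetric] digit_sum_Suc by simp
    moreover have "(s / q - a / (2 * q)) * (2 * q) = 2 * s - a" if "q > 0" for q a :: real
      using that by (simp add: field_simps)
    from this[of "2 ^ M" "real (f M) - 1"]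
    have "(s / 2 ^ M - (real (f M) - 1) / 2 ^ Suc M) * 2 ^ Suc M = 2 * s - (real (f M) - 1)"
      by simp
    ultimately have "real (f M) - 1 = s" "t = s" using digit_bound[OF f, of M] s by linarith+
    then show ?thesis unfolding t_def by (simp add: field_simps)
  qed
  have "real_of f - digit_sum f i = s / 2 ^ i"
    using \<open>N \<le> i\<close> by (induction rule: dec_induct) (use tail step in auto)
  then show ?thesis using step by blast
qed

lemma AC_I: "(\<And>y. y > x \<Longrightarrow> f y = c) \<Longrightarrow> f \<in> AC"
  unfolding AC_def by blast

lemma extremal_tail_imp_AC:
  assumes "range f \<subseteq> {0, 1, 2}" "\<bar>s\<bar> = 1" "real_of f - digit_sum f N = s / 2 ^ N"
  shows "f \<in> AC"
proof -
  have "f i = f N" if "N < i" for i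
    using extremal_tail_imp_const[OF assms, of i] extremal_tail_imp_const[OF assms, of N] that
    by simp
  then show ?thesis by (rule AC_I)
qed

text \<open>
  If the tail vanishes, then either all its digits are zero, or the first nonzero digit is
  cancelled by an extremal tail. (The digit zero is the value \<open>1\<close> of \<open>f\<close>.)
\<close>

lemma real_of_eq_digit_sum_imp_AC:
  assumes f: "range f \<subseteq> {0, 1, 2}" and eq: "real_of f = digit_sum f N"
  shows "f \<in> AC"
proof (cases "\<forall>i\<ge>N. f i = 1")
  case True
  then show ?thesis by (intro AC_I[of N f 1]) simp
next
  case False
  \<comment> \<open>The position of the first nonzero digit.\<close>
  define j where "j = (LEAST i. N \<le> i \<and> f i \<noteq> 1)"
  have j: "N \<le> j" "f j \<noteq> 1"
    using LeastI_ex[of "\<lambda>i. N \<le> i \<and> f i \<noteq> 1"] False unfolding j_def by auto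
  have before: "f i = 1" if "N \<le> i" "i < j" for i
    using not_less_Least[of i "\<lambda>i. N \<le> i \<and> f i \<noteq> 1"] that unfolding j_def by blast
  have "digit_sum f j = digit_sum f N"
    using j(1) before by (induction rule: dec_induct) (auto simp: digit_sum_Suc)
  then have "real_of f - digit_sum f (Suc j) = (1 - real (f j)) / 2 ^ Suc j"
    using eq unfolding digit_sum_Suc by (simp add: diff_divide_distrib)
  moreover have "f j \<in> {0, 2}" using f j(2) by blast
  then have "\<bar>1 - real (f j)\<bar> = 1" by auto
  ultimately show ?thesis using extremal_tail_imp_AC[OF f] by blast
qed

lemma AC_imp_tail_extremal_or_zero:
  assumes f: "range f \<subseteq> {0, 1, 2}" and "f \<in> AC"
  obtains N where "\<bar>real_of f - digit_sum f N\<bar> = 1 / 2 ^ N \<or> real_of f = digit_sum f N"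
proof -
  obtain c x where c: "\<And>y. y > x \<Longrightarrow> f y = c" using assms(2) by (auto simp: AC_def)
  then have "real_of f - digit_sum f (Suc x) = (real c - 1) / 2 ^ Suc x"
    by (intro real_of_tail_const[OF f]) simp
  moreover have "f (Suc x) \<in> {0, 1, 2}" using f by blast
  then have "c \<in> {0, 1, 2}" using c[of "Suc x"] by simp
  ultimately show thesis by (intro that[of "Suc x"]) auto
qed

text \<open>
  Almost constant functions are exactly the expansions of dyadic rationals, and their tails are
  eventually zero or extremal. Excluding such tails turns the conjunction of \<open>x = real_of f\<close> and
  \<open>f \<notin> AC\<close> into conditions each of which concerns a single initial segment of \<open>f\<close>.
\<close>

lemma real_of_not_AC_iff:
  assumes f: "range f \<subseteq> {0, 1, 2}"
  shows "x = real_of f \<and> f \<notin> AC \<longleftrightarrow>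
    (\<forall>N. \<bar>x - digit_sum f N\<bar> < 1 / 2 ^ N \<and> x \<noteq> digit_sum f N)" (is "?L \<longleftrightarrow> ?R")
proof
  assume L: ?L
  show ?R
  proof
    fix N
    have "\<bar>x - digit_sum f N\<bar> \<noteq> 1 / 2 ^ N"
    proof
      assume "\<bar>x - digit_sum f N\<bar> = 1 / 2 ^ N"
      then have "x - digit_sum f N = 1 / 2 ^ N \<or> x - digit_sum f N = - 1 / 2 ^ N" by linarith
      then show False
        using extremal_tail_imp_AC[OF f, of 1 N] extremal_tail_imp_AC[OF f, of "-1" N] L by auto
    qed
    then show "\<bar>x - digit_sum f N\<bar> < 1 / 2 ^ N \<and> x \<noteq> digit_sum f N"
      using real_of_tail_bound[OF f, of N] real_of_eq_digit_sum_imp_AC[OF f, of N] L by auto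
  qed
next
  assume R: ?R
  have "\<bar>x - real_of f\<bar> \<le> 2 / 2 ^ N" for N
  proof -
    have "\<bar>x - digit_sum f N\<bar> < 1 / 2 ^ N" using R by blast
    moreover have "2 / 2 ^ N = 1 / 2 ^ N + (1 / 2 ^ N :: real)" by simp
    ultimately show ?thesis using real_of_tail_bound[OF f, of N] by linarith
  qed
  moreover have "(\<lambda>N. 2 / 2 ^ N :: real) \<longlonglongrightarrow> 0"
    using tendsto_mult_right_zero[OF LIMSEQ_power_zero[of "1 / 2 :: real"], of 2]
    by (simp add: power_one_over)
  ultimately have "\<bar>x - real_of f\<bar> \<le> 0" by (intro LIMSEQ_le_const) auto
  then have x: "x = real_of f" by simp
  moreover have "f \<notin> AC"
  proof
    assume "f \<in> AC"
    then obtain N where "\<bar>real_of f - digit_sum f N\<bar> = 1 / 2 ^ N \<or> real_of f = digit_sum f N"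
      using AC_imp_tail_extremal_or_zero[OF f] by blast
    then show False using R x by (metis less_irrefl)
  qed
  ultimately show ?L ..
qed

lemma AC_real_in_generated_reals:
  assumes "unary ` AC \<subseteq> K" "f \<in> AC" "range f \<subseteq> {0, 1, 2}"
  shows "of_int m + real_of f \<in> generated_reals K"
  using assms unfolding generated_reals_def by blast

lemma digit_sum_in_generated_reals:
  assumes K: "unary ` AC \<subseteq> K" and f: "range f \<subseteq> {0, 1, 2}"
  shows "digit_sum f N \<in> generated_reals K"
proof -
  \<comment> \<open>Truncate \<open>f\<close> by zero digits.\<close>
  let ?g = "\<lambda>i. if i < N then f i else 1"
  have "?g \<in> AC" by (rule AC_I[of N _ 1]) simp
  moreover have "?g i \<in> {0, 1, 2}" for i using f by (cases "i < N") (simp, blast, simp)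
  then have "range ?g \<subseteq> {0, 1, 2}" by (rule image_subsetI)
  moreover have "real_of ?g = digit_sum f N"
  proof -
    have "real_of ?g = (\<Sum>i<N. (real (?g i) - 1) / 2 ^ (i + 1))"
      unfolding real_of_def by (rule suminf_finite) auto
    then show ?thesis by (simp add: digit_sum_def)
  qed
  ultimately show ?thesis using AC_real_in_generated_reals[OF K, of ?g 0] by simp
qed

lemma half_power_in_generated_reals:
  assumes K: "unary ` AC \<subseteq> K"
  shows "1 / 2 ^ N \<in> generated_reals K"
proof (cases N)
  case 0
  have "real_of (\<lambda>_. 1) = 0" by (simp add: real_of_def)
  moreover have "(\<lambda>_. 1) \<in> AC" by (auto simp: AC_def)
  ultimately show ?thesis using AC_real_in_generated_reals[OF K, of "\<lambda>_. 1" 1] 0 by simp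
next
  case (Suc M)
  let ?g = "\<lambda>i. if i = M then 2 else 1 :: nat"
  have "?g \<in> AC" by (rule AC_I[of M _ 1]) simp
  moreover have "real_of ?g = 1 / 2 ^ N"
  proof -
    have "real_of ?g = (\<Sum>i\<in>{M}. (real (?g i) - 1) / 2 ^ (i + 1))"
      unfolding real_of_def by (rule suminf_finite) auto
    then show ?thesis using Suc by simp
  qed
  ultimately show ?thesis using AC_real_in_generated_reals[OF K, of ?g 0] by auto
qed

section \<open>The set is a \<open>\<Sigma>\<^sup>0\<^sub>2\<close> set\<close>

text \<open>
  Let \<open>one\<close> be an index of \<open>1\<close>. The number \<open>w\<close> codes a list of pairs of \<open>\<mu>\<close>-indices, and
  \<open>digit_chain\<close> says that up to position \<open>N\<close> the \<open>i\<close>-th pair consists of indices of \<open>1 / 2 ^ i\<close> and of the partial sum of the first \<open>i\<close>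
  digits given by \<open>\<phi>\<^sub>n\<close>, where the values of \<open>\<phi>\<^sub>n\<close> are those that the derivation \<open>d\<close> concludes.
  Everything is expressed by the relation \<open>x + y = z\<close>. The first partial sum is characterised as the
  solution of \<open>x + x = x\<close> and then serves as the constant zero.
\<close>

definition digit_chain :: "(nat \<Rightarrow> real) \<Rightarrow> nat \<Rightarrow> nat \<Rightarrow> nat \<Rightarrow> nat \<Rightarrow> nat \<Rightarrow> bool" where
  "digit_chain \<mu> one n d w N \<longleftrightarrow>
    (let h = \<lambda>i. \<mu> (pfst (code_nth w i)); p = \<lambda>i. \<mu> (psnd (code_nth w i)) in
      p 0 + p 0 = p 0 \<and> h 0 + p 0 = \<mu> one \<and>
      (\<forall>i<N. h (Suc i) + h (Suc i) = h i \<and>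
        (concludes (list_decode d) n (code_Cons i 0) 0 \<and> p (Suc i) + h (Suc i) = p i \<or>
         concludes (list_decode d) n (code_Cons i 0) 1 \<and> p (Suc i) + p 0 = p i \<or>
         concludes (list_decode d) n (code_Cons i 0) 2 \<and> p i + h (Suc i) = p (Suc i))))"

text \<open>
  The condition of \<open>real_of_not_AC_iff\<close> at \<open>N\<close> for the real with index \<open>e\<close>: it lies strictly between
  \<open>p - h\<close> and \<open>p + h\<close> and differs from \<open>p\<close>, where \<open>h\<close> and \<open>p\<close> are given by the \<open>N\<close>-th pair.
  The second component of the pair at position \<open>0\<close> is used as an index of zero.
\<close>

definition digit_interval :: "(nat \<Rightarrow> real) \<Rightarrow> nat \<Rightarrow> nat \<Rightarrow> nat \<Rightarrow> bool" where
  "digit_interval \<mu> w N e \<longleftrightarrow>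
    (let h = \<mu> (pfst (code_nth w N)); p = \<mu> (psnd (code_nth w N)) in
      \<not> \<mu> e + h \<le> p \<and> \<not> p + h \<le> \<mu> e \<and> \<not> p + \<mu> (psnd (code_nth w 0)) = \<mu> e)"

lemma digit_chain_values:
  assumes one: "\<mu> one = 1" and d: "derivation (list_decode d)"
    and chain: "digit_chain \<mu> one n d w N" and f: "\<And>i v. phi n i = Some v \<Longrightarrow> f i = v"
    and "i \<le> N"
  shows "\<mu> (pfst (code_nth w i)) = 1 / 2 ^ i \<and> \<mu> (psnd (code_nth w i)) = digit_sum f i"
  using \<open>i \<le> N\<close>
proof (induction i)
  case 0
  then show ?case using chain one unfolding digit_chain_def Let_def by simp
next
  case (Suc i)
  have p0: "\<mu> (psnd (code_nth w 0)) = 0"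
    using chain unfolding digit_chain_def Let_def by simp
  have fi: "f i = v" if "concludes (list_decode d) n (code_Cons i 0) v" for v
    using f phi_eq_Some_iff d that by blast
  have "i < N" using Suc.prems by simp
  note step = chain[unfolded digit_chain_def Let_def, THEN conjunct2, THEN conjunct2,
      rule_format, OF this]
  have IH: "\<mu> (pfst (code_nth w i)) = 1 / 2 ^ i" "\<mu> (psnd (code_nth w i)) = digit_sum f i"
    using Suc by simp_all
  then have h: "\<mu> (pfst (code_nth w (Suc i))) = 1 / 2 ^ Suc i" using step by simp
  from step[THEN conjunct2] have "\<mu> (psnd (code_nth w (Suc i))) = digit_sum f (Suc i)"
    unfolding h p0 IH digit_sum_Suc by (elim disjE conjE) (simp_all add: fi)
  with h show ?case ..
qed

lemma digit_chain_exists: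
  assumes phi: "\<And>i. phi n i = Some (f i)" and f: "range f \<subseteq> {0, 1, 2}"
    and \<mu>: "\<mu> one = 1" "\<And>i. 1 / 2 ^ i \<in> range \<mu>" "\<And>i. digit_sum f i \<in> range \<mu>"
  obtains d w where "derivation (list_decode d)" "digit_chain \<mu> one n d w N"
proof -
  obtain d where d: "derivation (list_decode d)"
    "\<And>i. i < N \<Longrightarrow> concludes (list_decode d) n (code_Cons i 0) (f i)"
    using phi_agrees_common_derivation[of N n f] phi by blast
  define h where "h i = inv \<mu> (1 / 2 ^ i)" for i
  have h: "\<mu> (h i) = 1 / 2 ^ i" for i unfolding h_def by (rule f_inv_into_f[OF \<mu>(2)])
  define p where "p i = inv \<mu> (digit_sum f i)" for i
  have p: "\<mu> (p i) = digit_sum f i" for i unfolding p_def by (rule f_inv_into_f[OF \<mu>(3)])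
  define w where "w = list_encode (map (\<lambda>i. prod_encode (h i, p i)) [0..<Suc N])"
  have w: "code_nth w i = prod_encode (h i, p i)" if "i \<le> N" for i
    using that code_nth_eq[of i w] unfolding w_def by (simp del: upt_Suc)
  have "digit_chain \<mu> one n d w N"
    unfolding digit_chain_def Let_def
  proof (intro conjI allI impI)
    fix i assume i: "i < N"
    have "f i \<in> {0, 1, 2}" using f by blast
    then show "concludes (list_decode d) n (code_Cons i 0) 0 \<and>
          \<mu> (psnd (code_nth w (Suc i))) + \<mu> (pfst (code_nth w (Suc i))) = \<mu> (psnd (code_nth w i)) \<or>
        concludes (list_decode d) n (code_Cons i 0) 1 \<and>
          \<mu> (psnd (code_nth w (Suc i))) + \<mu> (psnd (code_nth w 0)) = \<mu> (psnd (code_nth w i)) \<or>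
        concludes (list_decode d) n (code_Cons i 0) 2 \<and>
          \<mu> (psnd (code_nth w i)) + \<mu> (pfst (code_nth w (Suc i))) = \<mu> (psnd (code_nth w (Suc i)))"
      using d(2)[OF i] i by (auto simp: w h p digit_sum_Suc)
  qed (simp_all add: w h p \<mu>)
  with d(1) show thesis by (rule that)
qed

text \<open>
  The decidable matrix of the \<open>\<Sigma>\<^sup>0\<^sub>2\<close> definition. The existential witness \<open>x\<close> is a pair: with first
  component \<open>0\<close> it claims that \<open>\<phi>\<^sub>n\<close> is undefined at the second component; otherwise it claims that the
  second component is an index of the real with expansion \<open>\<phi>\<^sub>n\<close>. The universal witness \<open>y\<close> codes a
  derivation \<open>d\<close>, a list \<open>w\<close> of pairs of indices, and a position \<open>N\<close>.
\<close>

definition matrix :: "(nat \<Rightarrow> real) \<Rightarrow> nat \<Rightarrow> nat \<Rightarrow> nat \<Rightarrow> nat \<Rightarrow> bool" where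
  "matrix \<mu> one n x y \<longleftrightarrow>
    (derivation (list_decode (pfst y)) \<longrightarrow>
      (\<forall>i<pfst y. \<forall>v<pfst y. concludes (list_decode (pfst y)) n (code_Cons i 0) v \<longrightarrow> v \<le> 2) \<and>
      (pfst x = 0 \<longrightarrow>
        (\<forall>v<pfst y. \<not> concludes (list_decode (pfst y)) n (code_Cons (psnd x) 0) v)) \<and>
      (pfst x \<noteq> 0 \<longrightarrow> digit_chain \<mu> one n (pfst y) (pfst (psnd y)) (psnd (psnd y)) \<longrightarrow>
        digit_interval \<mu> (pfst (psnd y)) (psnd (psnd y)) (psnd x)))"

lemma computable_rel_matrix:
  assumes le: "computable_rel 3 (\<lambda>ns. \<mu> (ns ! 0) + \<mu> (ns ! 1) \<le> \<mu> (ns ! 2))"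
    and ge: "computable_rel 3 (\<lambda>ns. \<mu> (ns ! 0) + \<mu> (ns ! 1) \<ge> \<mu> (ns ! 2))"
  shows "computable_rel 3 (\<lambda>xs. matrix \<mu> one (xs ! 0) (xs ! 1) (xs ! 2))"
proof (rule decidable_imp_computable_rel3)
  have le': "decidable (\<lambda>x. \<mu> (f x) + \<mu> (g x) \<le> \<mu> (h x))"
    if "recursive f" "recursive g" "recursive h" for f g h
    using decidable_rel3[OF le that] by simp
  have "decidable (\<lambda>x. \<mu> (h x) \<le> \<mu> (f x) + \<mu> (g x))"
    if "recursive f" "recursive g" "recursive h" for f g h
    using decidable_rel3[OF ge that] by simp
  then have eq': "decidable (\<lambda>x. \<mu> (f x) + \<mu> (g x) = \<mu> (h x))"
    if "recursive f" "recursive g" "recursive h" for f g h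
    unfolding eq_iff using that by (intro decidable_conj le')
  show "decidable (\<lambda>z. matrix \<mu> one (pfst z) (pfst (psnd z)) (psnd (psnd z)))"
    unfolding matrix_def digit_chain_def digit_interval_def Let_def
    by (intro le' eq' decidable_intros decidable_concludes decidable_derivation recursive_intros)
qed

lemma ran_phi_subset_iff:
  "ran (phi n) \<subseteq> {0, 1, 2} \<longleftrightarrow> (\<forall>d. derivation (list_decode d) \<longrightarrow>
    (\<forall>i<d. \<forall>v<d. concludes (list_decode d) n (code_Cons i 0) v \<longrightarrow> v \<le> 2))" (is "_ \<longleftrightarrow> ?R")
proof -
  have "i < d" if "concludes (list_decode d) n (code_Cons i 0) v" for d i v
    using concludes_less(1)[OF that] le_prod_encode_1[of i 0] by linarith
  then have "?R \<longleftrightarrow> (\<forall>i v. phi n i = Some v \<longrightarrow> v \<le> 2)"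
    unfolding phi_eq_Some_iff using concludes_less(2) by blast
  also have "\<dots> \<longleftrightarrow> ran (phi n) \<subseteq> {0, 1, 2}"
    by (force simp: ran_def)
  finally show ?thesis by blast
qed

lemma phi_eq_None_iff:
  "phi n x = None \<longleftrightarrow> (\<forall>d. derivation (list_decode d) \<longrightarrow>
    (\<forall>v<d. \<not> concludes (list_decode d) n (code_Cons x 0) v))"
  using phi_eq_Some_iff concludes_less(2) by (metis not_Some_eq)

lemma all_matrix_iff:
  "(\<forall>y. matrix \<mu> one n x y) \<longleftrightarrow> ran (phi n) \<subseteq> {0, 1, 2} \<and>
    (pfst x = 0 \<longrightarrow> phi n (psnd x) = None) \<and>
    (pfst x \<noteq> 0 \<longrightarrow> (\<forall>d w N. derivation (list_decode d) \<longrightarrow>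
      digit_chain \<mu> one n d w N \<longrightarrow> digit_interval \<mu> w N (psnd x)))"
proof -
  have triples: "(\<forall>y. Q (pfst y) (pfst (psnd y)) (psnd (psnd y))) \<longleftrightarrow> (\<forall>d w N. Q d w N)" for Q
    by (metis fst_conv prod_encode_inverse snd_conv)
  show ?thesis
    unfolding matrix_def ran_phi_subset_iff phi_eq_None_iff
    by (subst triples[of "\<lambda>d w N. derivation (list_decode d) \<longrightarrow>
      (\<forall>i<d. \<forall>v<d. concludes (list_decode d) n (code_Cons i 0) v \<longrightarrow> v \<le> 2) \<and>
      (pfst x = 0 \<longrightarrow> (\<forall>v<d. \<not> concludes (list_decode d) n (code_Cons (psnd x) 0) v)) \<and>
      (pfst x \<noteq> 0 \<longrightarrow> digit_chain \<mu> one n d w N \<longrightarrow> digit_interval \<mu> w N (psnd x))"]) blast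
qed

lemma digit_interval_all_iff:
  assumes phi: "\<And>i. phi n i = Some (f i)" and f: "range f \<subseteq> {0, 1, 2}"
    and \<mu>: "\<mu> one = 1" "\<And>i. 1 / 2 ^ i \<in> range \<mu>" "\<And>i. digit_sum f i \<in> range \<mu>"
  shows "(\<forall>d w N. derivation (list_decode d) \<longrightarrow> digit_chain \<mu> one n d w N \<longrightarrow>
      digit_interval \<mu> w N e) \<longleftrightarrow> \<mu> e = real_of f \<and> f \<notin> AC" (is "?L \<longleftrightarrow> _")
proof -
  have int: "digit_interval \<mu> w N e \<longleftrightarrow>
      \<bar>\<mu> e - digit_sum f N\<bar> < 1 / 2 ^ N \<and> \<mu> e \<noteq> digit_sum f N"
    if d: "derivation (list_decode d)" and chain: "digit_chain \<mu> one n d w N" for d w N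
  proof -
    have v: "\<mu> (pfst (code_nth w i)) = 1 / 2 ^ i \<and> \<mu> (psnd (code_nth w i)) = digit_sum f i"
      if "i \<le> N" for i
      using digit_chain_values[where \<mu> = \<mu> and one = one, OF \<mu>(1) d chain _ that, of f] phi
      by simp
    show ?thesis
      using v[of N] v[of 0] unfolding digit_interval_def Let_def by auto
  qed
  have "?L \<longleftrightarrow> (\<forall>N. \<bar>\<mu> e - digit_sum f N\<bar> < 1 / 2 ^ N \<and> \<mu> e \<noteq> digit_sum f N)"
  proof
    assume L: ?L
    show "\<forall>N. \<bar>\<mu> e - digit_sum f N\<bar> < 1 / 2 ^ N \<and> \<mu> e \<noteq> digit_sum f N"
    proof
      fix N
      obtain d w where "derivation (list_decode d)" "digit_chain \<mu> one n d w N"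
        using digit_chain_exists[where \<mu> = \<mu> and N = N, OF phi f \<mu>] by blast
      then show "\<bar>\<mu> e - digit_sum f N\<bar> < 1 / 2 ^ N \<and> \<mu> e \<noteq> digit_sum f N"
        using L int by blast
    qed
  qed (use int in blast)
  then show ?thesis using real_of_not_AC_iff[OF f, of "\<mu> e"] by blast
qed

theorem theorem2:
  fixes K :: "(nat list \<rightharpoonup> nat) set"
  assumes "\<forall>F\<in>K. total_computable F"
    and "unary ` AC \<subseteq> K"
    and "\<exists>\<mu>. computable_presentation \<mu> (generated_struct K)"
  shows "A0 \<union> (A2 K - A1) \<in> Sigma02"
proof -
  obtain \<mu> where pres: "computable_presentation \<mu> (generated_struct K)" using assms(3) ..
  then have range: "range \<mu> = generated_reals K"
    and rels: "\<And>k R. (k, R) \<in> set (relations (generated_struct K)) \<Longrightarrow>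
      computable_rel k (\<lambda>ns. R (map \<mu> ns))"
    unfolding computable_presentation_def by (auto simp: generated_struct_def)
  have le: "computable_rel 3 (\<lambda>ns. \<mu> (ns ! 0) + \<mu> (ns ! 1) \<le> \<mu> (ns ! 2))"
    using rels[of 3 "\<lambda>v. v ! 0 + v ! 1 \<le> v ! 2"]
    by (simp add: generated_struct_def computable_rel_def)
  have ge: "computable_rel 3 (\<lambda>ns. \<mu> (ns ! 0) + \<mu> (ns ! 1) \<ge> \<mu> (ns ! 2))"
    using rels[of 3 "\<lambda>v. v ! 0 + v ! 1 \<ge> v ! 2"]
    by (simp add: generated_struct_def computable_rel_def)
  have half: "1 / 2 ^ i \<in> range \<mu>" for i
    unfolding range using assms(2) by (rule half_power_in_generated_reals)
  then obtain one where one: "\<mu> one = 1" using half[of 0] by (metis div_by_1 imageE power_0)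
  have "n \<in> A0 \<union> (A2 K - A1) \<longleftrightarrow> (\<exists>x. \<forall>y. matrix \<mu> one n x y)" for n
  proof (cases "ran (phi n) \<subseteq> {0, 1, 2} \<and> n \<in> Tot")
    case False
    show ?thesis
    proof (cases "ran (phi n) \<subseteq> {0, 1, 2}")
      case True
      with False obtain x where "phi n x = None" by (auto simp: Tot_def)
      then have "\<forall>y. matrix \<mu> one n (prod_encode (0, x)) y" using True by (simp add: all_matrix_iff)
      then show ?thesis using True False by (auto simp: A0_def)
    qed (simp add: all_matrix_iff A0_def A2_def)
  next
    case True
    define f where "f = (\<lambda>x. the (phi n x))"
    have phi: "phi n i = Some (f i)" for i using True by (simp add: Tot_def f_def)
    have "f i \<in> {0, 1, 2}" for i using ranI[of "phi n" i, OF phi] True by blast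
    then have f: "range f \<subseteq> {0, 1, 2}" by (rule image_subsetI)
    have sum: "digit_sum f i \<in> range \<mu>" for i
      unfolding range using assms(2) f by (rule digit_sum_in_generated_reals)
    have "(\<forall>y. matrix \<mu> one n x y) \<longleftrightarrow> pfst x \<noteq> 0 \<and> \<mu> (psnd x) = real_of f \<and> f \<notin> AC" for x
      unfolding all_matrix_iff digit_interval_all_iff[where \<mu> = \<mu>, OF phi f one half sum]
      using True phi by auto
    moreover have "(\<exists>x. pfst x \<noteq> 0 \<and> \<mu> (psnd x) = real_of f) \<longleftrightarrow> (\<exists>e. \<mu> e = real_of f)"
      by (metis fst_conv prod_encode_inverse snd_conv zero_neq_one)
    moreover have "(\<exists>e. \<mu> e = real_of f) \<longleftrightarrow> real_of f \<in> generated_reals K"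
      unfolding range[symmetric] by (metis rangeE rangeI)
    moreover have "n \<in> A0 \<union> (A2 K - A1) \<longleftrightarrow> real_of f \<in> generated_reals K \<and> f \<notin> AC"
      using True by (auto simp: A0_def A1_def A2_def f_def)
    ultimately show ?thesis by blast
  qed
  then have "A0 \<union> (A2 K - A1) = {n. \<exists>x. \<forall>y. matrix \<mu> one n x y}" by blast
  then show ?thesis
    unfolding Sigma02_def using computable_rel_matrix[OF le ge, of one]
    by (intro CollectI exI[of _ "\<lambda>xs. matrix \<mu> one (xs ! 0) (xs ! 1) (xs ! 2)"]) simp
qed

end
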